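(* Let $(S,\mu,\prec)$ be an ordered probability space, and let $\mathcal W_\uparrow(S,\prec)$ be the set of monotone kernels on $(S,\prec)$. (i) $\mathcal W_\uparrow(S,\prec)$ is a compact subset of $L^1(S^2)$. (ii) Two kernels in $\mathcal W_\uparrow(S,\prec)$ are equivalent if and only if they are a.e. equal. (iii) The metrics $\|W_1-W_2\|_{L^1(S^2)}$, $\delta_1(W_1,W_2)$, $\|W_1-W_2\|_\square$ and $\delta_\square(W_1,W_2)$ are equivalent on $\mathcal W_\uparrow(S,\prec)$, i.e., they induce the same topology.
   Context: An ordered probability space $(S,\mu,\prec)$ is a probability space $(S,\mathcal F,\mu)$ together with a (strict) linear order $\prec$ on $S$ that is measurable, i.e., $\{(x,y):x\prec y\}$ is a measurable subset of $S\times S$ (with the product $\sigma$-field). A kernel on $S$ is a symmetric measurable function $W:S^2\to[0,1]$; kernels that are equal a.e. are identified. A kernel is monotone on $(S,\prec)$ if $W(x_1,y_1)\le W(x_2,y_2)$ whenever $x_1\preceq x_2$ and $y_1\preceq y_2$ (so an element of $L^1(S^2)$ belongs to $\mathcal W_\uparrow(S,\prec)$ if it has such a representative). For $W\in L^1(S^2)$ the cut norm is $\|W\|_\square=\sup\bigl|\int_{S^2}W(x,y)f(x)g(y)\,d\mu(x)\,d\mu(y)\bigr|$, the supremum being over all measurable $f,g:S\to[-1,1]$. For kernels $W_1$ on $S_1$ and $W_2$ on $S_2$ (arbitrary probability spaces), $$\delta_\square(W_1,W_2)=\inf\|W_1^{\varphi_1}-W_2^{\varphi_2}\|_\square,\qquad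 \delta_1(W_1,W_2)=\inf\|W_1^{\varphi_1}-W_2^{\varphi_2}\|_{L^1(S_3^2)},$$ where both infima are over all pairs of measure-preserving maps $\varphi_1:S_3\to S_1$, $\varphi_2:S_3\to S_2$ from a common probability space $S_3$, and $W^\varphi(x,y)=W(\varphi(x),\varphi(y))$. Two kernels are equivalent if $\delta_\square(W_1,W_2)=0$. *)

theory Defs
  imports "HOL-Probability.Probability"
begin

section \<open>The space of integrable functions modulo a.e. equality\<close>

definition L1_rel :: "'a measure \<Rightarrow> ('a \<Rightarrow> real) rel" where
  "L1_rel M = {(f, g). integrable M f \<and> integrable M g \<and> (AE z in M. f z = g z)}"

definition L1_space :: "'a measure \<Rightarrow> ('a \<Rightarrow> real) set set" where
  "L1_space M = {f. integrable M f} // L1_rel M"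

definition L1_class :: "'a measure \<Rightarrow> ('a \<Rightarrow> real) \<Rightarrow> ('a \<Rightarrow> real) set" where
  "L1_class M f = L1_rel M `` {f}"

definition L1_norm :: "'a measure \<Rightarrow> ('a \<Rightarrow> real) \<Rightarrow> real" where
  "L1_norm M f = (\<integral>z. \<bar>f z\<bar> \<partial>M)"

text \<open>
  Transfers a function of two integrable functions that respects a.e. equality to the quotient.
  The value outside the quotient is irrelevant; it is fixed to 0 because the locale
  \<^const>\<open>Metric_space\<close> asks for nonnegativity and symmetry on the whole type.
\<close>

definition L1_lift2 ::
  "'a measure \<Rightarrow> (('a \<Rightarrow> real) \<Rightarrow> ('a \<Rightarrow> real) \<Rightarrow> real) \<Rightarrow>
    ('a \<Rightarrow> real) set \<Rightarrow> ('a \<Rightarrow> real) set \<Rightarrow> real" where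
  "L1_lift2 M F A B =
    (if A \<in> L1_space M \<and> B \<in> L1_space M then the_elem (\<Union>f\<in>A. \<Union>g\<in>B. {F f g}) else 0)"

definition L1_dist :: "'a measure \<Rightarrow> ('a \<Rightarrow> real) \<Rightarrow> ('a \<Rightarrow> real) \<Rightarrow> real" where
  "L1_dist M f g = L1_norm M (\<lambda>z. f z - g z)"


section \<open>Kernels, cut norm and the distances between kernels\<close>

definition sym_kernel :: "'a measure \<Rightarrow> ('a \<times> 'a \<Rightarrow> real) \<Rightarrow> bool" where
  "sym_kernel M W \<longleftrightarrow> W \<in> borel_measurable (M \<Otimes>\<^sub>M M) \<and>
    (\<forall>x\<in>space M. \<forall>y\<in>space M. W (x, y) \<in> {0..1} \<and> W (x, y) = W (y, x))"

definition cut_norm :: "'a measure \<Rightarrow> ('a \<times> 'a \<Rightarrow> real) \<Rightarrow> real" where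
  "cut_norm M W =
    (SUP (f, g) \<in> {f \<in> borel_measurable M. \<forall>x\<in>space M. f x \<in> {-1..1}} \<times>
                 {g \<in> borel_measurable M. \<forall>y\<in>space M. g y \<in> {-1..1}}.
       \<bar>\<integral>(x, y). W (x, y) * f x * g y \<partial>(M \<Otimes>\<^sub>M M)\<bar>)"

definition cut_norm_dist :: "'a measure \<Rightarrow> ('a \<times> 'a \<Rightarrow> real) \<Rightarrow> ('a \<times> 'a \<Rightarrow> real) \<Rightarrow> real" where
  "cut_norm_dist M V W = cut_norm M (\<lambda>z. V z - W z)"

definition measure_preserving :: "'c measure \<Rightarrow> 'a measure \<Rightarrow> ('c \<Rightarrow> 'a) \<Rightarrow> bool" where
  "measure_preserving N M \<phi> \<longleftrightarrow> \<phi> \<in> measurable N M \<and> distr N M \<phi> = M"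

definition pullback :: "('c \<Rightarrow> 'a) \<Rightarrow> ('a \<times> 'a \<Rightarrow> real) \<Rightarrow> 'c \<times> 'c \<Rightarrow> real" where
  "pullback \<phi> W = (\<lambda>(x, y). W (\<phi> x, \<phi> y))"

definition couplings ::
  "'a measure \<Rightarrow> 'b measure \<Rightarrow> ('c measure \<times> ('c \<Rightarrow> 'a) \<times> ('c \<Rightarrow> 'b)) set" where
  "couplings M1 M2 = {(N, \<phi>1, \<phi>2). prob_space N \<and>
     measure_preserving N M1 \<phi>1 \<and> measure_preserving N M2 \<phi>2}"

text \<open>
  HOL cannot quantify over types inside a term, so the common probability space ranges over all
  probability spaces (with an arbitrary \<open>\<sigma>\<close>-algebra) on the type \<^typ>\<open>'a \<times> 'b\<close>.
  This loses nothing: \<open>delta_cut_le\<close> and \<open>delta_1_le\<close> below show that the infima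
  are lower bounds for the couplings on a probability space of any type.
\<close>

definition delta_cut ::
  "'a measure \<Rightarrow> 'b measure \<Rightarrow> ('a \<times> 'a \<Rightarrow> real) \<Rightarrow> ('b \<times> 'b \<Rightarrow> real) \<Rightarrow> real" where
  "delta_cut M1 M2 W1 W2 =
    (INF (N, \<phi>1, \<phi>2) \<in> (couplings M1 M2 ::
        (('a \<times> 'b) measure \<times> ('a \<times> 'b \<Rightarrow> 'a) \<times> ('a \<times> 'b \<Rightarrow> 'b)) set).
       cut_norm N (\<lambda>z. pullback \<phi>1 W1 z - pullback \<phi>2 W2 z))"

definition delta_1 ::
  "'a measure \<Rightarrow> 'b measure \<Rightarrow> ('a \<times> 'a \<Rightarrow> real) \<Rightarrow> ('b \<times> 'b \<Rightarrow> real) \<Rightarrow> real" where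
  "delta_1 M1 M2 W1 W2 =
    (INF (N, \<phi>1, \<phi>2) \<in> (couplings M1 M2 ::
        (('a \<times> 'b) measure \<times> ('a \<times> 'b \<Rightarrow> 'a) \<times> ('a \<times> 'b \<Rightarrow> 'b)) set).
       L1_norm (N \<Otimes>\<^sub>M N) (\<lambda>z. pullback \<phi>1 W1 z - pullback \<phi>2 W2 z))"

definition equivalent_kernels ::
  "'a measure \<Rightarrow> 'b measure \<Rightarrow> ('a \<times> 'a \<Rightarrow> real) \<Rightarrow> ('b \<times> 'b \<Rightarrow> real) \<Rightarrow> bool" where
  "equivalent_kernels M1 M2 W1 W2 \<longleftrightarrow> delta_cut M1 M2 W1 W2 = 0"


section \<open>Ordered probability spaces and monotone kernels\<close>

text \<open>
  The relation \<open>r\<close> is the strict order as a set of pairs; measurability entails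
  \<open>r \<subseteq> space M \<times> space M\<close>.
\<close>

locale ordered_prob_space = prob_space M for M :: "'a measure" +
  fixes r :: "'a rel"
  assumes order: "strict_linear_order_on (space M) r"
    and order_measurable: "r \<in> sets (M \<Otimes>\<^sub>M M)"

definition monotone_kernel :: "'a measure \<Rightarrow> 'a rel \<Rightarrow> ('a \<times> 'a \<Rightarrow> real) \<Rightarrow> bool" where
  "monotone_kernel M r W \<longleftrightarrow> sym_kernel M W \<and>
    (\<forall>x1\<in>space M. \<forall>x2\<in>space M. \<forall>y1\<in>space M. \<forall>y2\<in>space M.
       (x1, x2) \<in> r\<^sup>= \<and> (y1, y2) \<in> r\<^sup>= \<longrightarrow> W (x1, y1) \<le> W (x2, y2))"

definition monotone_kernels :: "'a measure \<Rightarrow> 'a rel \<Rightarrow> ('a \<times> 'a \<Rightarrow> real) set set" where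
  "monotone_kernels M r = {A \<in> L1_space (M \<Otimes>\<^sub>M M). \<exists>W\<in>A. monotone_kernel M r W}"


section \<open>Well-definedness\<close>

lemma equiv_L1_rel: "equiv {f. integrable M f} (L1_rel M)"
  by (rule equivI) (auto simp: L1_rel_def refl_on_def sym_def trans_def)

lemma L1_class_in_L1_space: "integrable M f \<Longrightarrow> L1_class M f \<in> L1_space M"
  unfolding L1_class_def L1_space_def by (rule quotientI) simp

lemma L1_space_cases:
  assumes "A \<in> L1_space M"
  obtains f where "integrable M f" "A = L1_class M f"
  using assms unfolding L1_class_def L1_space_def by (auto elim!: quotientE)

lemma L1_class_eq_iff:
  "integrable M f \<Longrightarrow> integrable M g \<Longrightarrow> L1_class M f = L1_class M g \<longleftrightarrow> (AE z in M. f z = g z)"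
  unfolding L1_class_def
  using eq_equiv_class_iff[OF equiv_L1_rel, of f M g] by (auto simp: L1_rel_def)

lemma L1_lift2_class:
  assumes "F respects2 L1_rel M" "integrable M f" "integrable M g"
  shows "L1_lift2 M F (L1_class M f) (L1_class M g) = F f g"
proof -
  have "f \<in> L1_class M f" "g \<in> L1_class M g"
    using assms by (auto simp: L1_class_def L1_rel_def)
  moreover have "F f' g' = F f g" if "f' \<in> L1_class M f" "g' \<in> L1_class M g" for f' g'
    using congruent2D[OF assms(1), of f f' g g'] that by (auto simp: L1_class_def)
  ultimately have "(\<Union>f'\<in>L1_class M f. \<Union>g'\<in>L1_class M g. {F f' g'}) = {F f g}"
    by blast
  then show ?thesis
    using assms by (simp add: L1_lift2_def L1_class_in_L1_space)
qed

lemma L1_dist_respects: "L1_dist M respects2 L1_rel M"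
proof (rule congruent2I')
  fix f f' g g' assume "(f, f') \<in> L1_rel M" "(g, g') \<in> L1_rel M"
  then show "L1_dist M f g = L1_dist M f' g'"
    unfolding L1_dist_def L1_norm_def L1_rel_def by (intro integral_cong_AE) auto
qed

lemma Metric_space_L1: "Metric_space (L1_space M) (L1_lift2 M (L1_dist M))"
proof
  note lift = L1_lift2_class[OF L1_dist_respects]
  fix A B C :: "('a \<Rightarrow> real) set"
  show "0 \<le> L1_lift2 M (L1_dist M) A B"
  proof (cases "A \<in> L1_space M \<and> B \<in> L1_space M")
    case True
    then show ?thesis
      by (auto elim!: L1_space_cases simp: lift L1_dist_def L1_norm_def)
  qed (auto simp: L1_lift2_def)
  show "L1_lift2 M (L1_dist M) A B = L1_lift2 M (L1_dist M) B A"
  proof (cases "A \<in> L1_space M \<and> B \<in> L1_space M")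
    case True
    then show ?thesis
      by (auto elim!: L1_space_cases simp: lift L1_dist_def L1_norm_def abs_minus_commute)
  qed (auto simp: L1_lift2_def)
  assume A: "A \<in> L1_space M" and B: "B \<in> L1_space M"
  from A obtain f where f: "integrable M f" "A = L1_class M f" by (rule L1_space_cases)
  from B obtain g where g: "integrable M g" "B = L1_class M g" by (rule L1_space_cases)
  have "L1_dist M f g = 0 \<longleftrightarrow> (AE z in M. \<bar>f z - g z\<bar> = 0)"
    unfolding L1_dist_def L1_norm_def
    by (rule integral_nonneg_eq_0_iff_AE) (use f g in auto)
  then show "L1_lift2 M (L1_dist M) A B = 0 \<longleftrightarrow> A = B"
    using f g by (simp add: lift L1_class_eq_iff)
  assume C: "C \<in> L1_space M"
  from C obtain h where h: "integrable M h" "C = L1_class M h" by (rule L1_space_cases)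
  have "L1_dist M f h \<le> (\<integral>z. \<bar>f z - g z\<bar> + \<bar>g z - h z\<bar> \<partial>M)"
    unfolding L1_dist_def L1_norm_def by (rule integral_mono) (use f g h in auto)
  also have "\<dots> = L1_dist M f g + L1_dist M g h"
    unfolding L1_dist_def L1_norm_def
    by (rule Bochner_Integration.integral_add) (use f g h in auto)
  finally show "L1_lift2 M (L1_dist M) A C \<le> L1_lift2 M (L1_dist M) A B + L1_lift2 M (L1_dist M) B C"
    using f g h by (simp add: lift)
qed

lemma measure_preserving_pair:
  assumes "prob_space N" "measure_preserving N M \<phi>"
  shows "(\<lambda>(x, y). (\<phi> x, \<phi> y)) \<in> measurable (N \<Otimes>\<^sub>M N) (M \<Otimes>\<^sub>M M)"
    and "distr (N \<Otimes>\<^sub>M N) (M \<Otimes>\<^sub>M M) (\<lambda>(x, y). (\<phi> x, \<phi> y)) = M \<Otimes>\<^sub>M M"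
proof -
  have [measurable]: "\<phi> \<in> measurable N M" and d: "distr N M \<phi> = M"
    using assms(2) by (auto simp: measure_preserving_def)
  show "(\<lambda>(x, y). (\<phi> x, \<phi> y)) \<in> measurable (N \<Otimes>\<^sub>M N) (M \<Otimes>\<^sub>M M)"
    by measurable
  interpret N: prob_space N by fact
  interpret D: prob_space "distr N M \<phi>" by (rule N.prob_space_distr) measurable
  have "distr N M \<phi> \<Otimes>\<^sub>M distr N M \<phi> = distr (N \<Otimes>\<^sub>M N) (M \<Otimes>\<^sub>M M) (\<lambda>(x, y). (\<phi> x, \<phi> y))"
    by (rule pair_measure_distr) (auto intro: D.sigma_finite_measure_axioms)
  then show "distr (N \<Otimes>\<^sub>M N) (M \<Otimes>\<^sub>M M) (\<lambda>(x, y). (\<phi> x, \<phi> y)) = M \<Otimes>\<^sub>M M"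
    by (simp only: d)
qed

lemma pullback_comp: "pullback \<phi> W = (\<lambda>z. W ((\<lambda>(x, y). (\<phi> x, \<phi> y)) z))"
  by (auto simp: pullback_def fun_eq_iff)

lemma integrable_pullback:
  assumes "prob_space N" "measure_preserving N M \<phi>" "integrable (M \<Otimes>\<^sub>M M) W"
  shows "integrable (N \<Otimes>\<^sub>M N) (pullback \<phi> W)"
  unfolding pullback_comp
  using measure_preserving_pair[OF assms(1,2)] assms(3) by (metis integrable_distr)

lemma integral_pullback:
  fixes W :: "'a \<times> 'a \<Rightarrow> real"
  assumes "prob_space N" "measure_preserving N M \<phi>" "W \<in> borel_measurable (M \<Otimes>\<^sub>M M)"
  shows "integral\<^sup>L (N \<Otimes>\<^sub>M N) (pullback \<phi> W) = integral\<^sup>L (M \<Otimes>\<^sub>M M) W"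
  unfolding pullback_comp
  using measure_preserving_pair[OF assms(1,2)] assms(3) by (metis integral_distr)

lemma AE_pullback:
  assumes "prob_space N" "measure_preserving N M \<phi>"
    and "AE z in M \<Otimes>\<^sub>M M. V z = W z"
  shows "AE z in N \<Otimes>\<^sub>M N. pullback \<phi> V z = pullback \<phi> W z"
proof -
  note m = measure_preserving_pair[OF assms(1,2)]
  from assms(3) m have "AE z in distr (N \<Otimes>\<^sub>M N) (M \<Otimes>\<^sub>M M) (\<lambda>(x, y). (\<phi> x, \<phi> y)). V z = W z"
    by (simp only:)
  from AE_distrD[OF m(1) this] show ?thesis
    by (simp add: pullback_comp)
qed

lemma cut_norm_bdd:
  assumes "integrable (M \<Otimes>\<^sub>M M) W"
    and "f \<in> borel_measurable M" "\<forall>x\<in>space M. f x \<in> {-1..1}"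
    and "g \<in> borel_measurable M" "\<forall>x\<in>space M. g x \<in> {-1..1}"
  shows "\<bar>\<integral>(x, y). W (x, y) * f x * g y \<partial>(M \<Otimes>\<^sub>M M)\<bar> \<le> L1_norm (M \<Otimes>\<^sub>M M) W"
proof -
  note [measurable] = assms(2,4) borel_measurable_integrable[OF assms(1)]
  have b: "\<bar>W (x, y) * f x * g y\<bar> \<le> \<bar>W (x, y)\<bar>" if "x \<in> space M" "y \<in> space M" for x y
  proof -
    have "\<bar>f x\<bar> \<le> 1" "\<bar>g y\<bar> \<le> 1" using assms that by (auto simp: abs_le_iff)
    then have "\<bar>f x\<bar> * \<bar>g y\<bar> \<le> 1" by (simp add: mult_le_one)
    then have "\<bar>W (x, y)\<bar> * (\<bar>f x\<bar> * \<bar>g y\<bar>) \<le> \<bar>W (x, y)\<bar> * 1"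
      by (intro mult_left_mono) auto
    then show ?thesis by (simp add: abs_mult mult.assoc)
  qed
  have i: "integrable (M \<Otimes>\<^sub>M M) (\<lambda>(x, y). W (x, y) * f x * g y)"
    by (rule Bochner_Integration.integrable_bound[OF assms(1)])
       (auto simp: space_pair_measure intro!: AE_I2 b)
  have "\<bar>\<integral>(x, y). W (x, y) * f x * g y \<partial>(M \<Otimes>\<^sub>M M)\<bar>
      \<le> (\<integral>z. \<bar>case z of (x, y) \<Rightarrow> W (x, y) * f x * g y\<bar> \<partial>(M \<Otimes>\<^sub>M M))"
    by (rule integral_abs_bound)
  also have "\<dots> \<le> L1_norm (M \<Otimes>\<^sub>M M) W"
    unfolding L1_norm_def using i assms(1)
    by (intro integral_mono) (auto simp: space_pair_measure b)
  finally show ?thesis .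
qed

lemma cut_norm_upper:
  assumes "integrable (M \<Otimes>\<^sub>M M) W"
    and "f \<in> borel_measurable M" "\<forall>x\<in>space M. f x \<in> {-1..1}"
    and "g \<in> borel_measurable M" "\<forall>x\<in>space M. g x \<in> {-1..1}"
  shows "\<bar>\<integral>(x, y). W (x, y) * f x * g y \<partial>(M \<Otimes>\<^sub>M M)\<bar> \<le> cut_norm M W"
  unfolding cut_norm_def
  by (rule cSUP_upper2[where x = "(f, g)"])
     (use assms in \<open>auto intro!: bdd_aboveI2[where M = "L1_norm (M \<Otimes>\<^sub>M M) W"] cut_norm_bdd\<close>)

lemma cut_norm_least:
  assumes "\<And>f g. f \<in> borel_measurable M \<Longrightarrow> \<forall>x\<in>space M. f x \<in> {-1..1} \<Longrightarrow>
      g \<in> borel_measurable M \<Longrightarrow> \<forall>x\<in>space M. g x \<in> {-1..1} \<Longrightarrow>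
      \<bar>\<integral>(x, y). W (x, y) * f x * g y \<partial>(M \<Otimes>\<^sub>M M)\<bar> \<le> c"
  shows "cut_norm M W \<le> c"
proof -
  have "(\<lambda>_. 0) \<in> {f \<in> borel_measurable M. \<forall>x\<in>space M. f x \<in> {-1..1::real}}" by auto
  then show ?thesis
    unfolding cut_norm_def
    by (intro cSUP_least) (blast, clarsimp, rule assms, auto)
qed

lemma cut_norm_nonneg:
  assumes "integrable (M \<Otimes>\<^sub>M M) W"
  shows "0 \<le> cut_norm M W"
  by (rule order_trans[OF abs_ge_zero cut_norm_upper[OF assms, of "\<lambda>_. 0" "\<lambda>_. 0"]]) auto

lemma cut_norm_cong:
  assumes "W \<in> borel_measurable (M \<Otimes>\<^sub>M M)" "V \<in> borel_measurable (M \<Otimes>\<^sub>M M)"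
    and "AE z in M \<Otimes>\<^sub>M M. V z = W z"
  shows "cut_norm M V = cut_norm M W"
proof -
  note [measurable] = assms(1,2)
  have "(\<integral>(x, y). V (x, y) * f x * g y \<partial>(M \<Otimes>\<^sub>M M)) = (\<integral>(x, y). W (x, y) * f x * g y \<partial>(M \<Otimes>\<^sub>M M))"
    if [measurable]: "f \<in> borel_measurable M" "g \<in> borel_measurable M" for f g
    by (rule integral_cong_AE) (measurable, use assms(3) in \<open>auto elim!: eventually_mono\<close>)
  then show ?thesis
    unfolding cut_norm_def by (intro SUP_cong) auto
qed

lemma cut_norm_le_pullback:
  assumes "prob_space N" "measure_preserving N M \<phi>" "integrable (M \<Otimes>\<^sub>M M) W"
  shows "cut_norm M W \<le> cut_norm N (pullback \<phi> W)"
proof (rule cut_norm_least)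
  fix f g :: "'b \<Rightarrow> real"
  assume fg: "f \<in> borel_measurable M" "\<forall>x\<in>space M. f x \<in> {-1..1}"
    "g \<in> borel_measurable M" "\<forall>x\<in>space M. g x \<in> {-1..1}"
  note [measurable] = fg(1,3) borel_measurable_integrable[OF assms(3)]
  have \<phi>[measurable]: "\<phi> \<in> measurable N M"
    using assms(2) by (simp add: measure_preserving_def)
  have "(\<integral>(x, y). W (x, y) * f x * g y \<partial>(M \<Otimes>\<^sub>M M)) =
      integral\<^sup>L (N \<Otimes>\<^sub>M N) (pullback \<phi> (\<lambda>(x, y). W (x, y) * f x * g y))"
    by (rule integral_pullback[OF assms(1,2), symmetric]) measurable
  also have "\<dots> = (\<integral>(x, y). pullback \<phi> W (x, y) * f (\<phi> x) * g (\<phi> y) \<partial>(N \<Otimes>\<^sub>M N))"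
    by (simp add: pullback_def)
  finally show "\<bar>\<integral>(x, y). W (x, y) * f x * g y \<partial>(M \<Otimes>\<^sub>M M)\<bar> \<le> cut_norm N (pullback \<phi> W)"
    using cut_norm_upper[OF integrable_pullback[OF assms], of "\<lambda>x. f (\<phi> x)" "\<lambda>x. g (\<phi> x)"]
      fg measurable_space[OF \<phi>] by auto
qed

lemma joint_coupling:
  fixes N :: "'c measure" and M1 :: "'a measure" and M2 :: "'b measure"
  assumes "(N, \<phi>1, \<phi>2) \<in> couplings M1 M2"
  defines "P \<equiv> distr N (M1 \<Otimes>\<^sub>M M2) (\<lambda>x. (\<phi>1 x, \<phi>2 x))"
  shows "(P, fst, snd) \<in> couplings M1 M2"
    and "measure_preserving N P (\<lambda>x. (\<phi>1 x, \<phi>2 x))"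
proof -
  have N: "prob_space N" and [measurable]: "\<phi>1 \<in> measurable N M1" "\<phi>2 \<in> measurable N M2"
    and d: "distr N M1 \<phi>1 = M1" "distr N M2 \<phi>2 = M2"
    using assms(1) by (auto simp: couplings_def measure_preserving_def)
  have "prob_space P" unfolding P_def by (rule prob_space.prob_space_distr[OF N]) measurable
  moreover have "distr P M1 fst = M1" "distr P M2 snd = M2"
    unfolding P_def using d by (simp_all add: distr_distr o_def)
  ultimately show "(P, fst, snd) \<in> couplings M1 M2"
    by (auto simp: couplings_def measure_preserving_def P_def)
  have "distr N P (\<lambda>x. (\<phi>1 x, \<phi>2 x)) = P"
    unfolding P_def by (rule distr_cong) auto
  then show "measure_preserving N P (\<lambda>x. (\<phi>1 x, \<phi>2 x))"
    by (auto simp: measure_preserving_def P_def)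
qed

lemma integrable_coupling_diff:
  assumes "(N, \<phi>1, \<phi>2) \<in> couplings M1 M2"
    and "integrable (M1 \<Otimes>\<^sub>M M1) W1" "integrable (M2 \<Otimes>\<^sub>M M2) W2"
  shows "integrable (N \<Otimes>\<^sub>M N) (\<lambda>z. pullback \<phi>1 W1 z - pullback \<phi>2 W2 z)"
  using assms by (auto simp: couplings_def intro!: Bochner_Integration.integrable_diff integrable_pullback)

lemma delta_cut_le:
  fixes N :: "'c measure" and M1 :: "'a measure" and M2 :: "'b measure"
  assumes N: "(N, \<phi>1, \<phi>2) \<in> couplings M1 M2"
    and W: "integrable (M1 \<Otimes>\<^sub>M M1) W1" "integrable (M2 \<Otimes>\<^sub>M M2) W2"
  shows "delta_cut M1 M2 W1 W2 \<le> cut_norm N (\<lambda>z. pullback \<phi>1 W1 z - pullback \<phi>2 W2 z)"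
proof -
  define P where "P = distr N (M1 \<Otimes>\<^sub>M M2) (\<lambda>x. (\<phi>1 x, \<phi>2 x))"
  note P = joint_coupling[OF N, folded P_def]
  let ?D = "\<lambda>z. pullback fst W1 z - pullback snd W2 z"
  have "delta_cut M1 M2 W1 W2 \<le> cut_norm P ?D"
    unfolding delta_cut_def
    by (rule cINF_lower2[OF _ P(1)])
       (auto intro!: bdd_belowI2[where m = 0] cut_norm_nonneg integrable_coupling_diff W)
  also have "\<dots> \<le> cut_norm N (pullback (\<lambda>x. (\<phi>1 x, \<phi>2 x)) ?D)"
    using N by (intro cut_norm_le_pullback P integrable_coupling_diff[OF P(1)] W) (simp add: couplings_def)
  also have "pullback (\<lambda>x. (\<phi>1 x, \<phi>2 x)) ?D = (\<lambda>z. pullback \<phi>1 W1 z - pullback \<phi>2 W2 z)"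
    by (auto simp: pullback_def)
  finally show ?thesis .
qed

lemma delta_1_le:
  fixes N :: "'c measure" and M1 :: "'a measure" and M2 :: "'b measure"
  assumes N: "(N, \<phi>1, \<phi>2) \<in> couplings M1 M2"
    and W: "integrable (M1 \<Otimes>\<^sub>M M1) W1" "integrable (M2 \<Otimes>\<^sub>M M2) W2"
  shows "delta_1 M1 M2 W1 W2 \<le> L1_norm (N \<Otimes>\<^sub>M N) (\<lambda>z. pullback \<phi>1 W1 z - pullback \<phi>2 W2 z)"
proof -
  define P where "P = distr N (M1 \<Otimes>\<^sub>M M2) (\<lambda>x. (\<phi>1 x, \<phi>2 x))"
  note P = joint_coupling[OF N, folded P_def]
  let ?D = "\<lambda>z. pullback fst W1 z - pullback snd W2 z"
  have "delta_1 M1 M2 W1 W2 \<le> L1_norm (P \<Otimes>\<^sub>M P) ?D"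
    unfolding delta_1_def
    by (rule cINF_lower2[OF _ P(1)])
       (auto intro!: bdd_belowI2[where m = 0] simp: L1_norm_def)
  also have "\<dots> = integral\<^sup>L (N \<Otimes>\<^sub>M N) (pullback (\<lambda>x. (\<phi>1 x, \<phi>2 x)) (\<lambda>z. \<bar>?D z\<bar>))"
    unfolding L1_norm_def
    using N borel_measurable_integrable[OF integrable_coupling_diff[OF P(1) W]]
    by (intro integral_pullback[symmetric] P) (auto simp: couplings_def)
  also have "\<dots> = L1_norm (N \<Otimes>\<^sub>M N) (\<lambda>z. pullback \<phi>1 W1 z - pullback \<phi>2 W2 z)"
    unfolding L1_norm_def by (rule arg_cong[where f = "integral\<^sup>L (N \<Otimes>\<^sub>M N)"]) (auto simp: pullback_def)
  finally show ?thesis .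
qed

lemma couplings_nonempty:
  fixes M1 :: "'a measure" and M2 :: "'b measure"
  assumes "prob_space M1" "prob_space M2"
  shows "(M1 \<Otimes>\<^sub>M M2, fst, snd) \<in> couplings M1 M2"
proof -
  interpret M1: prob_space M1 by fact
  interpret M2: prob_space M2 by fact
  interpret P: pair_prob_space M1 M2 ..
  have "distr (M1 \<Otimes>\<^sub>M M2) M1 fst = M1" by (rule M2.distr_pair_fst)
  moreover have "distr (M1 \<Otimes>\<^sub>M M2) M2 snd = M2"
  proof (rule measure_eqI)
    fix A assume "A \<in> sets (distr (M1 \<Otimes>\<^sub>M M2) M2 snd)"
    then have A: "A \<in> sets M2" by simp
    then have "snd -` A \<inter> space (M1 \<Otimes>\<^sub>M M2) = space M1 \<times> A"
      using sets.sets_into_space[OF A] by (auto simp: space_pair_measure)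
    then show "emeasure (distr (M1 \<Otimes>\<^sub>M M2) M2 snd) A = emeasure M2 A"
      using A by (simp add: emeasure_distr M2.emeasure_pair_measure_Times M1.emeasure_space_1)
  qed simp
  ultimately show ?thesis
    by (auto simp: couplings_def measure_preserving_def P.prob_space_axioms)
qed

lemma cut_norm_dist_respects: "cut_norm_dist M respects2 L1_rel (M \<Otimes>\<^sub>M M)"
proof (rule congruent2I')
  fix f f' g g' assume "(f, f') \<in> L1_rel (M \<Otimes>\<^sub>M M)" "(g, g') \<in> L1_rel (M \<Otimes>\<^sub>M M)"
  then show "cut_norm_dist M f g = cut_norm_dist M f' g'"
    unfolding cut_norm_dist_def L1_rel_def by (intro cut_norm_cong) auto
qed

lemma coupling_diff_cong:
  assumes "(N, \<phi>1, \<phi>2) \<in> couplings M1 M2"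
    and "(f, f') \<in> L1_rel (M1 \<Otimes>\<^sub>M M1)" "(g, g') \<in> L1_rel (M2 \<Otimes>\<^sub>M M2)"
  shows "AE z in N \<Otimes>\<^sub>M N. pullback \<phi>1 f z - pullback \<phi>2 g z = pullback \<phi>1 f' z - pullback \<phi>2 g' z"
proof -
  have "AE z in N \<Otimes>\<^sub>M N. pullback \<phi>1 f z = pullback \<phi>1 f' z"
    "AE z in N \<Otimes>\<^sub>M N. pullback \<phi>2 g z = pullback \<phi>2 g' z"
    using assms by (auto simp: couplings_def L1_rel_def intro!: AE_pullback)
  then show ?thesis by auto
qed

lemma delta_cut_respects: "congruent2 (L1_rel (M1 \<Otimes>\<^sub>M M1)) (L1_rel (M2 \<Otimes>\<^sub>M M2)) (delta_cut M1 M2)"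
proof (rule congruent2I')
  fix f f' g g'
  assume r: "(f, f') \<in> L1_rel (M1 \<Otimes>\<^sub>M M1)" "(g, g') \<in> L1_rel (M2 \<Otimes>\<^sub>M M2)"
  then have i: "integrable (M1 \<Otimes>\<^sub>M M1) f" "integrable (M1 \<Otimes>\<^sub>M M1) f'"
    "integrable (M2 \<Otimes>\<^sub>M M2) g" "integrable (M2 \<Otimes>\<^sub>M M2) g'" by (auto simp: L1_rel_def)
  show "delta_cut M1 M2 f g = delta_cut M1 M2 f' g'"
    unfolding delta_cut_def
    by (intro INF_cong refl)
       (auto intro!: cut_norm_cong coupling_diff_cong r borel_measurable_integrable
          integrable_coupling_diff i simp del: borel_measurable_diff)
qed

lemma delta_1_respects: "congruent2 (L1_rel (M1 \<Otimes>\<^sub>M M1)) (L1_rel (M2 \<Otimes>\<^sub>M M2)) (delta_1 M1 M2)"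
proof (rule congruent2I')
  fix f f' g g'
  assume r: "(f, f') \<in> L1_rel (M1 \<Otimes>\<^sub>M M1)" "(g, g') \<in> L1_rel (M2 \<Otimes>\<^sub>M M2)"
  then have i: "integrable (M1 \<Otimes>\<^sub>M M1) f" "integrable (M1 \<Otimes>\<^sub>M M1) f'"
    "integrable (M2 \<Otimes>\<^sub>M M2) g" "integrable (M2 \<Otimes>\<^sub>M M2) g'" by (auto simp: L1_rel_def)
  have "L1_norm (N \<Otimes>\<^sub>M N) (\<lambda>z. pullback \<phi>1 f z - pullback \<phi>2 g z) =
      L1_norm (N \<Otimes>\<^sub>M N) (\<lambda>z. pullback \<phi>1 f' z - pullback \<phi>2 g' z)"
    if N: "(N, \<phi>1, \<phi>2) \<in> couplings M1 M2" for N :: "('a \<times> 'b) measure" and \<phi>1 \<phi>2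
    unfolding L1_norm_def
    using coupling_diff_cong[OF N r] integrable_coupling_diff[OF N] i
    by (intro integral_cong_AE borel_measurable_abs borel_measurable_integrable)
       (auto elim!: eventually_mono)
  then show "delta_1 M1 M2 f g = delta_1 M1 M2 f' g'"
    unfolding delta_1_def by (intro INF_cong) auto
qed

end

theory Submission
  imports Defs "HOL-Complex_Analysis.Great_Picard"
begin

text \<open>
  Compactness is a Helly selection argument. Fubini applied to the measurable order yields a
  countable set \<open>D\<close> that meets every order-convex set of positive measure, so monotone kernels that
  agree on \<open>D \<times> D\<close> agree almost everywhere. Along a subsequence converging on \<open>D \<times> D\<close>, the upper
  and the lower limit are monotone and hence a.e. equal.

  Up-sets of a linear order are nested, so among all couplings the diagonal one maximises
  \<open>\<integral>min W1 W2\<close>; therefore \<open>\<delta>\<^sub>1\<close> coincides with the \<open>L\<^sup>1\<close> distance on monotone kernels. For a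
  coupling \<open>(\<phi>, \<psi>)\<close> let \<open>\<Delta> = W1\<^sup>\<phi> - W2\<^sup>\<psi>\<close>. Replacing \<open>W1\<close> and \<open>W2\<close> by step kernels in
  \<open>\<integral>\<Delta>\<^sup>2 = \<integral>\<Delta> W1\<^sup>\<phi> - \<integral>\<Delta> W2\<^sup>\<psi>\<close> shows that \<open>\<delta>\<^sub>\<box> = 0\<close> forces \<open>\<delta>\<^sub>1 = 0\<close>, which is (ii). Finally,
  \<open>\<delta>\<^sub>\<box>\<close> and the cut metric are metrics below the \<open>L\<^sup>1\<close> metric, whose topology is compact, so all
  topologies agree.
\<close>

section \<open>A countable set determining monotone functions\<close>

context ordered_prob_space
begin

text \<open>The space is arbitrary: nothing makes the order separable or the \<sigma>-field
  countably generated, so monotone functions cannot be moved to the real line by an order embedding.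
  The substitute is the distribution function \<open>rank\<close>, which loses only what happens
  inside its level sets, and the atomless part of a level set is null. The comparison of the cut
  norm with the L1 norm has an obstacle of its own: the factor in
  \<open>L1_norm_pullback_diff_le_cut_norm\<close> comes from step kernels approximating the two
  given kernels. It is independent of the coupling, so it survives the infimum, but it varies with
  the kernels. It is used only to find the zero set of \<open>delta_cut\<close>; compactness then
  turns this qualitative information into equality of topologies. For that, \<open>delta_cut\<close>
  has to be a metric, and its triangle inequality must be obtained on spaces without
  disintegrations. This is why the same step kernels return there, together with the fact that
  pulling back does not increase the cut norm.\<close>

lemma order_in_space: "(x, y) \<in> r \<Longrightarrow> x \<in> space M \<and> y \<in> space M"
  using sets.sets_into_space[OF order_measurable] by (auto simp: space_pair_measure)

lemma order_trans: "(x, y) \<in> r \<Longrightarrow> (y, z) \<in> r \<Longrightarrow> (x, z) \<in> r"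
  and order_irrefl: "(x, x) \<notin> r"
  and order_total: "x \<in> space M \<Longrightarrow> y \<in> space M \<Longrightarrow> x \<noteq> y \<Longrightarrow> (x, y) \<in> r \<or> (y, x) \<in> r"
  using order by (auto simp: strict_linear_order_on_def trans_def irrefl_def total_on_def)

lemma sets_below [measurable]: "{z. (z, x) \<in> r} \<in> sets M"
  using sets_Pair2[OF order_measurable, of x] by (simp add: vimage_def)

lemma sets_above [measurable]: "{z. (x, z) \<in> r} \<in> sets M"
  using sets_Pair1[OF order_measurable, of x] by (simp add: vimage_def)

lemma sets_singleton: "x \<in> space M \<Longrightarrow> {x} \<in> sets M"
proof -
  assume "x \<in> space M"
  then have "{x} = space M - {z. (z, x) \<in> r} - {z. (x, z) \<in> r}"
    using order_total order_irrefl by auto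
  then show ?thesis by simp
qed

text \<open>Exchanging the two quantifiers by Fubini shows that a typical point of \<open>A\<close>
  has almost nothing of \<open>A\<close> below it as well as above it. By totality only the point
  itself remains, and it is not an atom; hence one typical point in \<open>A\<close> already makes
  \<open>A\<close> null.\<close>

lemma null_if_AE_incomparable:
  assumes A [measurable]: "A \<in> sets M" and atoms: "\<And>x. x \<in> A \<Longrightarrow> measure M {x} = 0"
    and inc: "AE x in M. AE z in M. \<not> (x \<in> A \<and> z \<in> A \<and> (x, z) \<in> r)"
  shows "A \<in> null_sets M"
proof -
  interpret P: pair_prob_space M M ..
  note [measurable] = order_measurable
  have inc': "AE z in M. AE x in M. \<not> (x \<in> A \<and> z \<in> A \<and> (x, z) \<in> r)"
    using inc by (subst P.AE_commute[symmetric]) simp_all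
  have "AE x in M. x \<in> A \<longrightarrow> A \<in> null_sets M"
    using inc inc' AE_space
  proof eventually_elim
    case (elim x)
    show ?case
    proof
      assume "x \<in> A"
      have "AE z in M. z \<noteq> x"
        using atoms[OF \<open>x \<in> A\<close>] sets_singleton[OF elim(3)]
        by (intro AE_I[where N = "{x}"]) (auto simp: emeasure_eq_measure)
      moreover note elim(1,2) AE_space
      ultimately have "AE z in M. z \<notin> A"
        by eventually_elim (use \<open>x \<in> A\<close> elim(3) order_total in blast)
      then show "A \<in> null_sets M" by (simp add: AE_iff_null_sets)
    qed
  qed
  moreover have ?thesis if "A \<notin> null_sets M" "AE x in M. x \<in> A \<longrightarrow> A \<in> null_sets M"
    using that by (auto simp: AE_iff_null_sets)
  ultimately show ?thesis by blast
qed

text \<open>The distribution function of the measure along the order. Being only weakly monotone, it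
  decides the order of two points just when their ranks differ; points of equal rank are left to
  \<open>null_if_rank_const\<close>.\<close>

definition rank :: "'a \<Rightarrow> real" where
  "rank x = measure M {z. (z, x) \<in> r}"

lemma rank_measurable [measurable]: "rank \<in> borel_measurable M"
proof -
  interpret P: pair_prob_space M M ..
  have "(\<lambda>x. measure M ((\<lambda>z. (z, x)) -` r)) \<in> borel_measurable M"
    unfolding measure_def using P.measurable_emeasure_Pair2[OF order_measurable] by measurable
  then show ?thesis by (simp add: rank_def[abs_def] vimage_def)
qed

lemma rank_mono: "(x, y) \<in> r \<Longrightarrow> rank x \<le> rank y"
  unfolding rank_def by (rule finite_measure_mono) (auto intro: order_trans)

lemma rank_less_imp_order:
  "x \<in> space M \<Longrightarrow> y \<in> space M \<Longrightarrow> rank x < rank y \<Longrightarrow> (x, y) \<in> r"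
  using order_total[of x y] rank_mono[of y x] by (cases "x = y") auto

lemma AE_below_if_rank_eq:
  assumes "(x, y) \<in> r" "rank x = rank y"
  shows "AE z in M. (z, y) \<in> r \<longrightarrow> (z, x) \<in> r"
proof -
  have "measure M ({z. (z, y) \<in> r} - {z. (z, x) \<in> r}) = rank y - rank x"
    unfolding rank_def using assms(1) by (intro finite_measure_Diff) (auto intro: order_trans)
  then show ?thesis
    using assms(2)
    by (intro AE_I[where N = "{z. (z, y) \<in> r} - {z. (z, x) \<in> r}"]) (auto simp: emeasure_eq_measure)
qed

text \<open>Between two points of equal rank lies a null interval, but a set of constant rank may be
  an uncountable union of such intervals. Cutting at a reference point \<open>x0\<close> supplies a
  common end: what lies in \<open>?L\<close> above \<open>x\<close> is inside
  \<open>[x, x0)\<close>, and what lies in \<open>?R\<close> below \<open>x\<close> is inside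
  \<open>[x0, x)\<close>. So almost all pairs within each half are incomparable.\<close>

lemma null_if_rank_const:
  assumes A [measurable]: "A \<in> sets M" and atoms: "\<And>x. x \<in> A \<Longrightarrow> measure M {x} = 0"
    and const: "\<And>x y. x \<in> A \<Longrightarrow> y \<in> A \<Longrightarrow> rank x = rank y"
  shows "A \<in> null_sets M"
proof (cases "A = {}")
  case False
  then obtain x0 where x0: "x0 \<in> A" by auto
  interpret P: pair_prob_space M M ..
  note [measurable] = order_measurable
  have A_space: "x \<in> A \<Longrightarrow> x \<in> space M" for x using sets.sets_into_space[OF A] by auto
  let ?L = "A \<inter> {z. (z, x0) \<in> r}" and ?R = "A - {z. (z, x0) \<in> r}"
  have "AE z in M. \<not> (x \<in> ?L \<and> z \<in> ?L \<and> (x, z) \<in> r)" for x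
  proof (cases "x \<in> ?L")
    case True
    then have "AE z in M. (z, x0) \<in> r \<longrightarrow> (z, x) \<in> r"
      by (intro AE_below_if_rank_eq const x0) auto
    then show ?thesis
      by eventually_elim (use order_trans[of x _ x] order_irrefl[of x] in blast)
  qed auto
  then have "?L \<in> null_sets M"
    by (intro null_if_AE_incomparable) (auto simp: atoms)
  moreover have R: "AE z in M. \<not> (z \<in> ?R \<and> x \<in> ?R \<and> (z, x) \<in> r)" for x
  proof (cases "x \<in> ?R \<and> x \<noteq> x0")
    case True
    then have "AE z in M. (z, x) \<in> r \<longrightarrow> (z, x0) \<in> r"
      using order_total[of x x0] A_space x0 by (intro AE_below_if_rank_eq const) auto
    then show ?thesis by eventually_elim blast
  qed auto
  \<comment> \<open>\<open>R\<close> speaks of the points below \<open>x\<close>, whereas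
    \<open>null_if_AE_incomparable\<close> asks for those above the outer variable; hence the
    exchange.\<close>
  have "AE z in M. AE x in M. \<not> (z \<in> ?R \<and> x \<in> ?R \<and> (z, x) \<in> r)"
  proof (subst P.AE_commute)
    show "AE x in M. AE z in M. \<not> (z \<in> ?R \<and> x \<in> ?R \<and> (z, x) \<in> r)"
      by (rule AE_I2) (rule R)
  qed measurable
  then have "?R \<in> null_sets M"
    by (intro null_if_AE_incomparable) (auto simp: atoms)
  ultimately have "?L \<union> ?R \<in> null_sets M" by (rule null_sets.Un)
  then show ?thesis by (simp add: Int_Diff_Un)
qed simp

lemma obtain_order_dense:
  obtains D where "countable D" "D \<subseteq> space M"
    "\<And>C. C \<in> sets M \<Longrightarrow> C \<inter> D = {} \<Longrightarrow>
      (\<And>x y z. x \<in> C \<Longrightarrow> y \<in> C \<Longrightarrow> (x, z) \<in> r \<Longrightarrow> (z, y) \<in> r \<Longrightarrow> z \<in> C) \<Longrightarrow> C \<in> null_sets M"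
proof -
  define between where "between = (\<lambda>(p, q). {x \<in> space M. p < rank x \<and> rank x < q})"
  \<comment> \<open>A single atom is an order-convex set of positive measure, so all atoms must
    belong to \<open>D\<close>; a finite measure has countably many. The points chosen in rational
    rank intervals deal with sets on which \<open>rank\<close> varies.\<close>
  define D where "D = {x \<in> space M. measure M {x} \<noteq> 0} \<union>
    (\<lambda>pq. SOME x. x \<in> between pq) ` {pq \<in> \<rat> \<times> \<rat>. between pq \<noteq> {}}"
  have some: "(SOME x. x \<in> between pq) \<in> between pq" if "between pq \<noteq> {}" for pq
    using that by (simp add: some_in_eq)
  show thesis
  proof
    have "countable {x \<in> space M. measure M {x} \<noteq> 0}"
      by (rule countable_subset[OF _ countable_support]) auto
    then show "countable D"
      unfolding D_def
      by (intro countable_Un countable_image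
          countable_subset[OF Collect_restrict[of "\<rat> \<times> \<rat>"]] countable_SIGMA countable_rat)
    show "D \<subseteq> space M"
      unfolding D_def using some by (fastforce simp: between_def)
    fix C assume C [measurable]: "C \<in> sets M" and avoid: "C \<inter> D = {}"
      and conv: "\<And>x y z. x \<in> C \<Longrightarrow> y \<in> C \<Longrightarrow> (x, z) \<in> r \<Longrightarrow> (z, y) \<in> r \<Longrightarrow> z \<in> C"
    have C_space: "x \<in> C \<Longrightarrow> x \<in> space M" for x using sets.sets_into_space[OF C] by auto
    have atoms: "x \<in> C \<Longrightarrow> measure M {x} = 0" for x
      using avoid C_space by (auto simp: D_def)
    \<comment> \<open>Convexity captures a chosen point only if it lies strictly between two points
      of \<open>C\<close>. The middle point \<open>y\<close> makes the rational interval nonempty,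
      and the outer two enclose whatever point was chosen there. This leaves at most two levels,
      each of them null.\<close>
    have two_ranks: False
      if xyz: "x \<in> C" "y \<in> C" "z \<in> C" "rank x < rank y" "rank y < rank z" for x y z
    proof -
      obtain p q where pq: "p \<in> \<rat>" "q \<in> \<rat>" "rank x < p" "p < rank y" "rank y < q" "q < rank z"
        using Rats_dense_in_real xyz(4,5) by metis
      then have ne: "between (p, q) \<noteq> {}" using xyz(2) C_space by (auto simp: between_def)
      define d where "d = (SOME x. x \<in> between (p, q))"
      have d: "d \<in> between (p, q)" unfolding d_def by (rule some[OF ne])
      have "d \<in> D" unfolding D_def d_def using ne pq by blast
      moreover have "d \<in> C"
      proof (rule conv[OF xyz(1,3)])
        show "(x, d) \<in> r" "(d, z) \<in> r"
          using d pq xyz C_space by (auto simp: between_def intro!: rank_less_imp_order)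
      qed
      ultimately show False using avoid by auto
    qed
    have level: "{z \<in> C. rank z = c} \<in> null_sets M" for c
    proof (rule null_if_rank_const)
      have "{z \<in> C. rank z = c} = C \<inter> {z \<in> space M. rank z = c}" using C_space by auto
      then show "{z \<in> C. rank z = c} \<in> sets M" by simp
    qed (auto simp: atoms)
    show "C \<in> null_sets M"
    proof (cases "\<exists>x\<in>C. \<exists>y\<in>C. rank x < rank y")
      case True
      then obtain x y where xy: "x \<in> C" "y \<in> C" "rank x < rank y" by auto
      have "C = {z \<in> C. rank z = rank x} \<union> {z \<in> C. rank z = rank y}"
        using two_ranks xy by (auto, metis linorder_neqE)
      also have "\<dots> \<in> null_sets M" by (intro null_sets.Un level)
      finally show ?thesis .
    next
      case False
      then have const: "rank x = rank y" if "x \<in> C" "y \<in> C" for x y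
        using that by (cases "rank x" "rank y" rule: linorder_cases) blast+
      show ?thesis by (rule null_if_rank_const[OF C atoms const])
    qed
  qed
qed

end


section \<open>Compactness\<close>

lemma (in prob_space) sym_kernel_integrable:
  assumes "sym_kernel M W"
  shows "integrable (M \<Otimes>\<^sub>M M) W"
proof -
  interpret P: pair_prob_space M M ..
  show ?thesis
    by (rule P.integrable_const_bound[where B = 1])
       (use assms in \<open>auto simp: sym_kernel_def space_pair_measure intro!: AE_I2\<close>)
qed

lemma L1_space_eq_class:
  assumes "A \<in> L1_space M" "f \<in> A"
  shows "integrable M f" "A = L1_class M f"
proof -
  from assms(1) obtain g where g: "integrable M g" "A = L1_class M g" by (rule L1_space_cases)
  with assms(2) have "(g, f) \<in> L1_rel M" by (simp add: L1_class_def)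
  then show "integrable M f" "A = L1_class M f"
    using g by (auto simp: L1_rel_def L1_class_eq_iff)
qed

lemma (in ordered_prob_space) monotone_kernel_integrable:
  "monotone_kernel M r W \<Longrightarrow> integrable (M \<Otimes>\<^sub>M M) W"
  by (simp add: monotone_kernel_def sym_kernel_integrable)

lemma (in ordered_prob_space) monotone_kernels_eq:
  "monotone_kernels M r = L1_class (M \<Otimes>\<^sub>M M) ` {W. monotone_kernel M r W}"
  using monotone_kernel_integrable unfolding monotone_kernels_def
  by (auto simp: L1_class_in_L1_space dest: L1_space_eq_class)
     (auto simp: L1_class_def L1_rel_def)

section \<open>Monotone functions and kernels determined on a countable set; Helly selection\<close>

context ordered_prob_space
begin

text \<open>For monotone \<open>u\<close> and \<open>v\<close> the set where
  \<open>u \<le> q < v\<close> is order-convex: \<open>u\<close> is controlled by the upper end of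
  an interval and \<open>v\<close> by the lower end. It misses \<open>D\<close>, where the functions
  agree, so it is null; rational \<open>q\<close> exhaust the set where
  \<open>u < v\<close>.\<close>

lemma obtain_determining_set:
  obtains D where "countable D" "D \<subseteq> space M"
    "\<And>u v :: 'a \<Rightarrow> real. u \<in> borel_measurable M \<Longrightarrow> v \<in> borel_measurable M \<Longrightarrow>
      (\<And>x y. (x, y) \<in> r \<Longrightarrow> u x \<le> u y) \<Longrightarrow> (\<And>x y. (x, y) \<in> r \<Longrightarrow> v x \<le> v y) \<Longrightarrow>
      (\<And>x. x \<in> D \<Longrightarrow> u x = v x) \<Longrightarrow> AE x in M. u x = v x"
proof -
  obtain D where D: "countable D" "D \<subseteq> space M"
    and null: "\<And>C. C \<in> sets M \<Longrightarrow> C \<inter> D = {} \<Longrightarrow>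
      (\<And>x y z. x \<in> C \<Longrightarrow> y \<in> C \<Longrightarrow> (x, z) \<in> r \<Longrightarrow> (z, y) \<in> r \<Longrightarrow> z \<in> C) \<Longrightarrow> C \<in> null_sets M"
    by (rule obtain_order_dense) blast
  have le: "AE x in M. v x \<le> u x"
    if [measurable]: "u \<in> borel_measurable M" "v \<in> borel_measurable M"
      and u: "\<And>x y. (x, y) \<in> r \<Longrightarrow> u x \<le> u y" and v: "\<And>x y. (x, y) \<in> r \<Longrightarrow> v x \<le> v y"
      and eq: "\<And>x. x \<in> D \<Longrightarrow> u x = v x" for u v :: "'a \<Rightarrow> real"
  proof -
    have "AE x in M. \<not> (u x \<le> q \<and> q < v x)" for q
    proof -
      have "{x \<in> space M. u x \<le> q \<and> q < v x} \<in> null_sets M"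
      proof (rule null)
        fix x y z assume "x \<in> {x \<in> space M. u x \<le> q \<and> q < v x}"
          "y \<in> {x \<in> space M. u x \<le> q \<and> q < v x}" "(x, z) \<in> r" "(z, y) \<in> r"
        then show "z \<in> {x \<in> space M. u x \<le> q \<and> q < v x}"
          using u[of z y] v[of x z] order_in_space[of z y] by auto
      qed (use eq in fastforce)+
      then show ?thesis by (simp add: AE_iff_null_sets[symmetric] AE_iff_null)
    qed
    then have "AE x in M. \<forall>q\<in>\<rat>. \<not> (u x \<le> q \<and> q < v x)"
      by (simp add: AE_ball_countable countable_rat)
    then show ?thesis
    proof eventually_elim
      case (elim x)
      then show ?case
        using Rats_dense_in_real[of "u x" "v x"] by (meson less_imp_le not_le)
    qed
  qed
  show thesis
  proof (rule that[OF D])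
    fix u v :: "'a \<Rightarrow> real"
    assume m: "u \<in> borel_measurable M" "v \<in> borel_measurable M"
      and u: "\<And>x y. (x, y) \<in> r \<Longrightarrow> u x \<le> u y" and v: "\<And>x y. (x, y) \<in> r \<Longrightarrow> v x \<le> v y"
      and eq: "\<And>x. x \<in> D \<Longrightarrow> u x = v x"
    have "AE x in M. v x \<le> u x" by (rule le[OF m u v eq])
    moreover have "AE x in M. u x \<le> v x" by (rule le[OF m(2,1) v u eq[symmetric]])
    ultimately show "AE x in M. u x = v x" by eventually_elim auto
  qed
qed

lemma monotone_kernelD:
  assumes "monotone_kernel M r W"
  shows "W \<in> borel_measurable (M \<Otimes>\<^sub>M M)"
    and "x \<in> space M \<Longrightarrow> y \<in> space M \<Longrightarrow> 0 \<le> W (x, y)"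
    and "x \<in> space M \<Longrightarrow> y \<in> space M \<Longrightarrow> W (x, y) \<le> 1"
    and "(x, x') \<in> r \<Longrightarrow> y \<in> space M \<Longrightarrow> W (x, y) \<le> W (x', y)"
    and "(y, y') \<in> r \<Longrightarrow> x \<in> space M \<Longrightarrow> W (x, y) \<le> W (x, y')"
  using assms order_in_space[of x x'] order_in_space[of y y']
  by (auto simp: monotone_kernel_def sym_kernel_def)

text \<open>The one-variable statement is used twice with the same \<open>D\<close>: with the second
  argument fixed in \<open>D\<close>, and then, after countably many null sets have been discarded,
  with a typical first argument fixed.\<close>

lemma obtain_determining_set_kernel:
  obtains D where "countable D" "D \<subseteq> space M"
    "\<And>U V. monotone_kernel M r U \<Longrightarrow> monotone_kernel M r V \<Longrightarrow>
      (\<And>x y. x \<in> D \<Longrightarrow> y \<in> D \<Longrightarrow> U (x, y) = V (x, y)) \<Longrightarrow> AE z in M \<Otimes>\<^sub>M M. U z = V z"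
proof -
  obtain D where D: "countable D" "D \<subseteq> space M"
    and det: "\<And>u v :: 'a \<Rightarrow> real. u \<in> borel_measurable M \<Longrightarrow> v \<in> borel_measurable M \<Longrightarrow>
      (\<And>x y. (x, y) \<in> r \<Longrightarrow> u x \<le> u y) \<Longrightarrow> (\<And>x y. (x, y) \<in> r \<Longrightarrow> v x \<le> v y) \<Longrightarrow>
      (\<And>x. x \<in> D \<Longrightarrow> u x = v x) \<Longrightarrow> AE x in M. u x = v x"
    by (rule obtain_determining_set) blast
  show thesis
  proof (rule that[OF D])
    fix U V assume U: "monotone_kernel M r U" and V: "monotone_kernel M r V"
      and eq: "\<And>x y. x \<in> D \<Longrightarrow> y \<in> D \<Longrightarrow> U (x, y) = V (x, y)"
    note [measurable] = monotone_kernelD(1)[OF U] monotone_kernelD(1)[OF V]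
    interpret P: pair_prob_space M M ..
    have "AE x in M. U (x, y) = V (x, y)" if y: "y \<in> D" for y
    proof -
      have [measurable]: "y \<in> space M" using y D(2) by auto
      show ?thesis
        using y D(2)
        by (intro det)
           (auto simp: eq subset_iff intro: monotone_kernelD(4)[OF U] monotone_kernelD(4)[OF V])
    qed
    then have "AE x in M. \<forall>y\<in>D. U (x, y) = V (x, y)"
      by (simp add: AE_ball_countable D(1))
    then have "AE x in M. AE y in M. U (x, y) = V (x, y)"
      using AE_space
    proof eventually_elim
      case (elim x)
      then show ?case
        by (intro det) (auto intro: monotone_kernelD(5)[OF U] monotone_kernelD(5)[OF V])
    qed
    then show "AE z in M \<Otimes>\<^sub>M M. U z = V z"
      by (intro P.AE_pair_measure) auto
  qed
qed

text \<open>\<open>L\<close> stands for \<open>limsup\<close> or \<open>liminf\<close>. Monotonicity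
  of \<open>L\<close> and its value on constants confine the limit to the unit interval, so that
  \<open>real_of_ereal\<close> loses nothing on the space.\<close>

lemma monotone_kernel_ereal_limit:
  fixes L :: "(nat \<Rightarrow> ereal) \<Rightarrow> ereal"
  assumes W: "\<And>n. monotone_kernel M r (W n)"
    and mono: "\<And>X Y. (\<And>n. X n \<le> Y n) \<Longrightarrow> L X \<le> L Y" and const: "\<And>c. L (\<lambda>_. c) = c"
    and meas: "(\<lambda>z. L (\<lambda>n. ereal (W n z))) \<in> borel_measurable (M \<Otimes>\<^sub>M M)"
  shows "monotone_kernel M r (\<lambda>z. real_of_ereal (L (\<lambda>n. ereal (W n z))))"
    and "x \<in> space M \<Longrightarrow> y \<in> space M \<Longrightarrow>
      ereal (real_of_ereal (L (\<lambda>n. ereal (W n (x, y))))) = L (\<lambda>n. ereal (W n (x, y)))"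
proof -
  have bounds: "0 \<le> L (\<lambda>n. ereal (W n (x, y)))" "L (\<lambda>n. ereal (W n (x, y))) \<le> 1"
    if "x \<in> space M" "y \<in> space M" for x y
    using mono[of "\<lambda>_. 0" "\<lambda>n. ereal (W n (x, y))"] mono[of "\<lambda>n. ereal (W n (x, y))" "\<lambda>_. 1"]
      monotone_kernelD(2,3)[OF W] that by (simp_all add: const)
  show real: "ereal (real_of_ereal (L (\<lambda>n. ereal (W n (x, y))))) = L (\<lambda>n. ereal (W n (x, y)))"
    if "x \<in> space M" "y \<in> space M" for x y
    using bounds[OF that] by (cases "L (\<lambda>n. ereal (W n (x, y)))") auto
  have sym: "W n (x, y) = W n (y, x)" if "x \<in> space M" "y \<in> space M" for n x y
    using W[of n] that by (simp add: monotone_kernel_def sym_kernel_def)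
  have le: "L (\<lambda>n. ereal (W n (x1, y1))) \<le> L (\<lambda>n. ereal (W n (x2, y2)))"
    if "x1 \<in> space M" "x2 \<in> space M" "y1 \<in> space M" "y2 \<in> space M"
      "(x1, x2) \<in> r\<^sup>=" "(y1, y2) \<in> r\<^sup>=" for x1 x2 y1 y2
    using W that by (intro mono) (auto simp: monotone_kernel_def)
  show "monotone_kernel M r (\<lambda>z. real_of_ereal (L (\<lambda>n. ereal (W n z))))"
    unfolding monotone_kernel_def sym_kernel_def
  proof (intro conjI ballI impI)
    show "(\<lambda>z. real_of_ereal (L (\<lambda>n. ereal (W n z)))) \<in> borel_measurable (M \<Otimes>\<^sub>M M)"
      using meas by measurable
    fix x y assume xy: "x \<in> space M" "y \<in> space M"
    show "real_of_ereal (L (\<lambda>n. ereal (W n (x, y)))) \<in> {0..1}"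
      using bounds[OF xy] by (cases "L (\<lambda>n. ereal (W n (x, y)))") auto
    show "real_of_ereal (L (\<lambda>n. ereal (W n (x, y)))) = real_of_ereal (L (\<lambda>n. ereal (W n (y, x))))"
      by (simp only: sym[OF xy])
  next
    fix x1 x2 y1 y2
    assume s: "x1 \<in> space M" "x2 \<in> space M" "y1 \<in> space M" "y2 \<in> space M"
      and o: "(x1, x2) \<in> r\<^sup>= \<and> (y1, y2) \<in> r\<^sup>="
    show "real_of_ereal (L (\<lambda>n. ereal (W n (x1, y1)))) \<le> real_of_ereal (L (\<lambda>n. ereal (W n (x2, y2))))"
      using le[OF s] o bounds[OF s(1,3)] bounds[OF s(2,4)]
      by (intro real_of_ereal_positive_mono) auto
  qed
qed

lemma monotone_kernel_convergent_subsequence: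
  fixes W :: "nat \<Rightarrow> 'a \<times> 'a \<Rightarrow> real"
  assumes W: "\<And>n. monotone_kernel M r (W n)"
  obtains V k where "monotone_kernel M r V" "strict_mono k"
    "(\<lambda>n. L1_dist (M \<Otimes>\<^sub>M M) (W (k n)) V) \<longlonglongrightarrow> 0"
proof -
  obtain D where D: "countable D" "D \<subseteq> space M"
    and det: "\<And>U V. monotone_kernel M r U \<Longrightarrow> monotone_kernel M r V \<Longrightarrow>
      (\<And>x y. x \<in> D \<Longrightarrow> y \<in> D \<Longrightarrow> U (x, y) = V (x, y)) \<Longrightarrow> AE z in M \<Otimes>\<^sub>M M. U z = V z"
    by (rule obtain_determining_set_kernel) blast
  interpret P: pair_prob_space M M ..
  have bound: "norm (W n z) \<le> 1" if "z \<in> D \<times> D" for n z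
    using that D(2) monotone_kernelD(2,3)[OF W[of n], of "fst z" "snd z"]
    by (auto simp: subset_iff)
  have "countable (D \<times> D)" using D(1) by simp
  \<comment> \<open>Cantor's diagonal choice for a uniformly bounded sequence on a countable
    set.\<close>
  then obtain k where k: "strict_mono (k :: nat \<Rightarrow> nat)"
    and conv: "\<And>z. z \<in> D \<times> D \<Longrightarrow> \<exists>l. (\<lambda>n. W (k n) z) \<longlonglongrightarrow> l"
    using function_convergent_subsequence[of "D \<times> D" W 1] bound by blast
  have Wm [measurable]: "W n \<in> borel_measurable (M \<Otimes>\<^sub>M M)" for n
    by (rule monotone_kernelD(1)[OF W])
  define U where "U z = real_of_ereal (limsup (\<lambda>n. ereal (W (k n) z)))" for z
  define V where "V z = real_of_ereal (liminf (\<lambda>n. ereal (W (k n) z)))" for z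
  note limits = monotone_kernel_ereal_limit[where W = "\<lambda>n. W (k n)", OF W]
  have U: "monotone_kernel M r U" unfolding U_def[abs_def]
    by (rule limits) (auto intro!: Limsup_mono simp: Limsup_const)
  have V: "monotone_kernel M r V" unfolding V_def[abs_def]
    by (rule limits) (auto intro!: Liminf_mono simp: Liminf_const)
  have Ureal: "ereal (U (x, y)) = limsup (\<lambda>n. ereal (W (k n) (x, y)))"
    if "x \<in> space M" "y \<in> space M" for x y
    unfolding U_def
    by (rule limits(2)[where L = limsup]) (auto intro!: Limsup_mono simp: Limsup_const that)
  have Vreal: "ereal (V (x, y)) = liminf (\<lambda>n. ereal (W (k n) (x, y)))"
    if "x \<in> space M" "y \<in> space M" for x y
    unfolding V_def
    by (rule limits(2)[where L = liminf]) (auto intro!: Liminf_mono simp: Liminf_const that)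
  have "AE z in M \<Otimes>\<^sub>M M. U z = V z"
  proof (rule det[OF U V])
    fix x y assume "x \<in> D" "y \<in> D"
    then obtain l where "(\<lambda>n. W (k n) (x, y)) \<longlonglongrightarrow> l" using conv[of "(x, y)"] by auto
    then have "(\<lambda>n. ereal (W (k n) (x, y))) \<longlonglongrightarrow> ereal l" by simp
    from lim_imp_Limsup[OF _ this] lim_imp_Liminf[OF _ this] show "U (x, y) = V (x, y)"
      unfolding U_def V_def by simp
  qed
  then have lim: "AE z in M \<Otimes>\<^sub>M M. (\<lambda>n. W (k n) z) \<longlonglongrightarrow> V z"
    using AE_space
  proof eventually_elim
    case (elim z)
    then have "(\<lambda>n. ereal (W (k n) z)) \<longlonglongrightarrow> ereal (V z)"
      using Ureal[of "fst z" "snd z"] Vreal[of "fst z" "snd z"]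
      unfolding tendsto_iff_Liminf_eq_Limsup[OF trivial_limit_sequentially]
      by (auto simp: space_pair_measure)
    then show ?case by simp
  qed
  have [measurable]: "V \<in> borel_measurable (M \<Otimes>\<^sub>M M)" by (rule monotone_kernelD(1)[OF V])
  have "(\<lambda>n. \<integral>z. \<bar>W (k n) z - V z\<bar> \<partial>(M \<Otimes>\<^sub>M M)) \<longlonglongrightarrow> (\<integral>z. 0 \<partial>(M \<Otimes>\<^sub>M M))"
  proof (rule integral_dominated_convergence[where w = "\<lambda>_. 1"])
    show "AE z in M \<Otimes>\<^sub>M M. (\<lambda>n. \<bar>W (k n) z - V z\<bar>) \<longlonglongrightarrow> 0"
      using lim by eventually_elim (auto intro!: tendsto_rabs_zero simp: LIM_zero_iff)
    show "AE z in M \<Otimes>\<^sub>M M. norm \<bar>W (k n) z - V z\<bar> \<le> 1" for n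
    proof (rule AE_I2)
      fix z assume "z \<in> space (M \<Otimes>\<^sub>M M)"
      then obtain x y where "z = (x, y)" "x \<in> space M" "y \<in> space M"
        by (auto simp: space_pair_measure)
      then show "norm \<bar>W (k n) z - V z\<bar> \<le> 1"
        using monotone_kernelD(2,3)[OF V, of x y] monotone_kernelD(2,3)[OF W[of "k n"], of x y]
        by (simp add: abs_le_iff)
    qed
  qed simp_all
  then have "(\<lambda>n. L1_dist (M \<Otimes>\<^sub>M M) (W (k n)) V) \<longlonglongrightarrow> 0"
    by (simp add: L1_dist_def L1_norm_def)
  then show thesis by (rule that[OF V k])
qed

lemma compactin_monotone_kernels:
  "compactin (Metric_space.mtopology (L1_space (M \<Otimes>\<^sub>M M)) (L1_lift2 (M \<Otimes>\<^sub>M M) (L1_dist (M \<Otimes>\<^sub>M M))))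
     (monotone_kernels M r)"
proof -
  interpret L1: Metric_space "L1_space (M \<Otimes>\<^sub>M M)" "L1_lift2 (M \<Otimes>\<^sub>M M) (L1_dist (M \<Otimes>\<^sub>M M))"
    by (rule Metric_space_L1)
  note lift = L1_lift2_class[OF L1_dist_respects]
  note int = monotone_kernel_integrable
  show ?thesis
    unfolding L1.compactin_sequentially
  proof (intro conjI allI impI)
    show "monotone_kernels M r \<subseteq> L1_space (M \<Otimes>\<^sub>M M)" by (auto simp: monotone_kernels_def)
    fix \<sigma> :: "nat \<Rightarrow> ('a \<times> 'a \<Rightarrow> real) set"
    assume "range \<sigma> \<subseteq> monotone_kernels M r"
    then have "\<forall>n. \<exists>W. monotone_kernel M r W \<and> \<sigma> n = L1_class (M \<Otimes>\<^sub>M M) W"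
      unfolding monotone_kernels_eq by blast
    then obtain W where W: "\<And>n. monotone_kernel M r (W n)" "\<And>n. \<sigma> n = L1_class (M \<Otimes>\<^sub>M M) (W n)"
      by metis
    obtain V k where V: "monotone_kernel M r V" "strict_mono k"
      "(\<lambda>n. L1_dist (M \<Otimes>\<^sub>M M) (W (k n)) V) \<longlonglongrightarrow> 0"
      using monotone_kernel_convergent_subsequence[of W] W(1) by blast
    have "limitin L1.mtopology (\<sigma> \<circ> k) (L1_class (M \<Otimes>\<^sub>M M) V) sequentially"
      unfolding L1.limitin_metric_dist_null
      using V W by (auto simp: lift int L1_class_in_L1_space)
    then show "\<exists>l k. l \<in> monotone_kernels M r \<and> strict_mono k \<and> limitin L1.mtopology (\<sigma> \<circ> k) l sequentially"
      using V unfolding monotone_kernels_eq by blast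
  qed
qed

end


section \<open>The diagonal coupling is optimal in \<open>L\<^sup>1\<close>\<close>

text \<open>Fubini for the region \<open>0 \<le> t < f x\<close> under the graph. It reduces
  integral inequalities to inequalities between measures of super-level sets.\<close>

lemma (in sigma_finite_measure) nn_integral_layer_cake:
  fixes f :: "'a \<Rightarrow> real"
  assumes [measurable]: "f \<in> borel_measurable M" and nonneg: "\<And>x. x \<in> space M \<Longrightarrow> 0 \<le> f x"
  shows "(\<integral>\<^sup>+x. ennreal (f x) \<partial>M) =
    (\<integral>\<^sup>+t. indicator {0..} t * emeasure M {x \<in> space M. t < f x} \<partial>lborel)"
proof -
  interpret P: pair_sigma_finite lborel M ..
  have "(\<integral>\<^sup>+x. ennreal (f x) \<partial>M) =
      (\<integral>\<^sup>+x. (\<integral>\<^sup>+t. (if 0 \<le> t \<and> t < f x then 1 else 0) \<partial>lborel) \<partial>M)"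
  proof (rule nn_integral_cong)
    fix x assume "x \<in> space M"
    have "(\<integral>\<^sup>+t. (if 0 \<le> t \<and> t < f x then 1 else 0) \<partial>lborel) = (\<integral>\<^sup>+t. indicator {0..<f x} t \<partial>lborel)"
      by (rule nn_integral_cong) (auto split: split_indicator)
    then show "ennreal (f x) = (\<integral>\<^sup>+t. (if 0 \<le> t \<and> t < f x then 1 else 0) \<partial>lborel)"
      using nonneg[OF \<open>x \<in> space M\<close>] by simp
  qed
  also have "\<dots> = (\<integral>\<^sup>+t. (\<integral>\<^sup>+x. (if 0 \<le> t \<and> t < f x then 1 else 0) \<partial>M) \<partial>lborel)"
    by (rule P.Fubini') measurable
  also have "\<dots> = (\<integral>\<^sup>+t. indicator {0..} t * emeasure M {x \<in> space M. t < f x} \<partial>lborel)"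
  proof (rule nn_integral_cong)
    fix t :: real
    have "(\<integral>\<^sup>+x. (if 0 \<le> t \<and> t < f x then 1 else 0) \<partial>M) =
        (\<integral>\<^sup>+x. indicator {0..} t * indicator {x \<in> space M. t < f x} x \<partial>M)"
      by (rule nn_integral_cong) (auto split: split_indicator)
    then show "(\<integral>\<^sup>+x. (if 0 \<le> t \<and> t < f x then 1 else 0) \<partial>M) =
        indicator {0..} t * emeasure M {x \<in> space M. t < f x}"
      by (simp add: nn_integral_cmult)
  qed
  finally show ?thesis .
qed

lemma couplingsD:
  assumes "(N, \<phi>, \<psi>) \<in> couplings M1 M2"
  shows "prob_space N" "measure_preserving N M1 \<phi>" "measure_preserving N M2 \<psi>"
    "\<phi> \<in> measurable N M1" "\<psi> \<in> measurable N M2" "distr N M1 \<phi> = M1" "distr N M2 \<psi> = M2"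
  using assms by (auto simp: couplings_def measure_preserving_def)

context ordered_prob_space
begin

text \<open>By the layer cake formula it suffices to compare super-level sets. Those of \<open>u\<close> and
  \<open>v\<close> are up-sets of a linear order, hence nested, so on the diagonal coupling their intersection
  has the largest possible measure.\<close>

lemma nn_integral_min_coupling_le:
  fixes u v :: "'a \<Rightarrow> real"
  assumes N: "(N, \<phi>, \<psi>) \<in> couplings M M"
    and [measurable]: "u \<in> borel_measurable M" "v \<in> borel_measurable M"
    and mono: "\<And>x y. (x, y) \<in> r \<Longrightarrow> u x \<le> u y" "\<And>x y. (x, y) \<in> r \<Longrightarrow> v x \<le> v y"
    and nonneg: "\<And>x. x \<in> space M \<Longrightarrow> 0 \<le> u x" "\<And>x. x \<in> space M \<Longrightarrow> 0 \<le> v x"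
  shows "(\<integral>\<^sup>+s. ennreal (min (u (\<phi> s)) (v (\<psi> s))) \<partial>N) \<le> (\<integral>\<^sup>+x. ennreal (min (u x) (v x)) \<partial>M)"
proof -
  note [measurable] = couplingsD(4,5)[OF N]
  interpret N: prob_space N by (rule couplingsD[OF N])
  have level: "emeasure N {s \<in> space N. t < min (u (\<phi> s)) (v (\<psi> s))} \<le>
      emeasure M {x \<in> space M. t < min (u x) (v x)}" for t
  proof -
    define A B where "A = {x \<in> space M. t < u x}" and "B = {x \<in> space M. t < v x}"
    have [measurable]: "A \<in> sets M" "B \<in> sets M" by (simp_all add: A_def B_def)
    have nested: "A \<subseteq> B \<or> B \<subseteq> A"
    proof (rule ccontr)
      assume "\<not> (A \<subseteq> B \<or> B \<subseteq> A)"
      then obtain x y where xy: "x \<in> A" "x \<notin> B" "y \<in> B" "y \<notin> A" by auto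
      then have "x \<noteq> y" "x \<in> space M" "y \<in> space M" by (auto simp: A_def B_def)
      then consider "(x, y) \<in> r" | "(y, x) \<in> r" using order_total by blast
      then show False
        by cases (use xy mono[of x y] mono[of y x] in \<open>auto simp: A_def B_def\<close>)
    qed
    have "{s \<in> space N. t < min (u (\<phi> s)) (v (\<psi> s))} = (\<phi> -` A \<inter> space N) \<inter> (\<psi> -` B \<inter> space N)"
      using measurable_space[of \<phi> N M] measurable_space[of \<psi> N M] by (auto simp: A_def B_def)
    then have "emeasure N {s \<in> space N. t < min (u (\<phi> s)) (v (\<psi> s))} \<le>
        min (emeasure N (\<phi> -` A \<inter> space N)) (emeasure N (\<psi> -` B \<inter> space N))"
      by (auto intro!: emeasure_mono)
    also have "\<dots> = min (emeasure M A) (emeasure M B)"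
      using emeasure_distr[of \<phi> N M A] emeasure_distr[of \<psi> N M B] couplingsD(6,7)[OF N] by simp
    also have "\<dots> \<le> emeasure M (A \<inter> B)"
      using nested by (auto simp: min_le_iff_disj inf.absorb1 inf.absorb2)
    also have "A \<inter> B = {x \<in> space M. t < min (u x) (v x)}" by (auto simp: A_def B_def)
    finally show ?thesis .
  qed
  have "(\<integral>\<^sup>+s. ennreal (min (u (\<phi> s)) (v (\<psi> s))) \<partial>N) =
      (\<integral>\<^sup>+t. indicator {0..} t * emeasure N {s \<in> space N. t < min (u (\<phi> s)) (v (\<psi> s))} \<partial>lborel)"
    using measurable_space[of \<phi> N M] measurable_space[of \<psi> N M]
    by (intro N.nn_integral_layer_cake) (auto simp: nonneg)
  also have "\<dots> \<le> (\<integral>\<^sup>+t. indicator {0..} t * emeasure M {x \<in> space M. t < min (u x) (v x)} \<partial>lborel)"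
    by (intro nn_integral_mono mult_left_mono level) simp
  also have "\<dots> = (\<integral>\<^sup>+x. ennreal (min (u x) (v x)) \<partial>M)"
    by (intro nn_integral_layer_cake[symmetric]) (auto simp: nonneg)
  finally show ?thesis .
qed

text \<open>The coupling is replaced by the diagonal in one coordinate at a time. With
  \<open>s\<close> fixed, the sections at \<open>\<phi> s\<close> and \<open>\<psi> s\<close> are
  still monotone although taken at different points, so the one-variable inequality applies; after
  Fubini it applies again with \<open>y\<close> fixed.\<close>

lemma nn_integral_min_pullback_le:
  assumes N: "(N, \<phi>, \<psi>) \<in> couplings M M"
    and W1: "monotone_kernel M r W1" and W2: "monotone_kernel M r W2"
  shows "(\<integral>\<^sup>+z. ennreal (min (pullback \<phi> W1 z) (pullback \<psi> W2 z)) \<partial>(N \<Otimes>\<^sub>M N)) \<le>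
    (\<integral>\<^sup>+z. ennreal (min (W1 z) (W2 z)) \<partial>(M \<Otimes>\<^sub>M M))"
proof -
  note [measurable] = couplingsD(4,5)[OF N] monotone_kernelD(1)[OF W1] monotone_kernelD(1)[OF W2]
  interpret N: prob_space N by (rule couplingsD[OF N])
  interpret NM: pair_sigma_finite N M ..
  interpret MM: pair_sigma_finite M M ..
  have space: "s \<in> space N \<Longrightarrow> \<phi> s \<in> space M" "s \<in> space N \<Longrightarrow> \<psi> s \<in> space M" for s
    using measurable_space[of \<phi> N M] measurable_space[of \<psi> N M] by auto
  have "(\<integral>\<^sup>+z. ennreal (min (pullback \<phi> W1 z) (pullback \<psi> W2 z)) \<partial>(N \<Otimes>\<^sub>M N)) =
      (\<integral>\<^sup>+s. (\<integral>\<^sup>+t. ennreal (min (W1 (\<phi> s, \<phi> t)) (W2 (\<psi> s, \<psi> t))) \<partial>N) \<partial>N)"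
    by (subst N.nn_integral_fst[symmetric]) (simp_all add: pullback_def)
  also have "\<dots> \<le> (\<integral>\<^sup>+s. (\<integral>\<^sup>+y. ennreal (min (W1 (\<phi> s, y)) (W2 (\<psi> s, y))) \<partial>M) \<partial>N)"
  proof (rule nn_integral_mono)
    fix s assume "s \<in> space N"
    note [measurable] = space[OF this]
    show "(\<integral>\<^sup>+t. ennreal (min (W1 (\<phi> s, \<phi> t)) (W2 (\<psi> s, \<psi> t))) \<partial>N) \<le>
        (\<integral>\<^sup>+y. ennreal (min (W1 (\<phi> s, y)) (W2 (\<psi> s, y))) \<partial>M)"
      by (rule nn_integral_min_coupling_le[OF N])
         (auto intro: monotone_kernelD[OF W1] monotone_kernelD[OF W2] space[OF \<open>s \<in> space N\<close>])
  qed
  also have "\<dots> = (\<integral>\<^sup>+y. (\<integral>\<^sup>+s. ennreal (min (W1 (\<phi> s, y)) (W2 (\<psi> s, y))) \<partial>N) \<partial>M)"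
    by (rule NM.Fubini'[symmetric]) measurable
  also have "\<dots> \<le> (\<integral>\<^sup>+y. (\<integral>\<^sup>+x. ennreal (min (W1 (x, y)) (W2 (x, y))) \<partial>M) \<partial>M)"
  proof (rule nn_integral_mono)
    fix y assume y [measurable]: "y \<in> space M"
    show "(\<integral>\<^sup>+s. ennreal (min (W1 (\<phi> s, y)) (W2 (\<psi> s, y))) \<partial>N) \<le>
        (\<integral>\<^sup>+x. ennreal (min (W1 (x, y)) (W2 (x, y))) \<partial>M)"
      by (rule nn_integral_min_coupling_le[OF N, of "\<lambda>x. W1 (x, y)" "\<lambda>x. W2 (x, y)"])
         (auto intro: monotone_kernelD[OF W1] monotone_kernelD[OF W2] y)
  qed
  also have "\<dots> = (\<integral>\<^sup>+z. ennreal (min (W1 z) (W2 z)) \<partial>(M \<Otimes>\<^sub>M M))"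
    by (subst MM.nn_integral_snd[symmetric]) simp_all
  finally show ?thesis .
qed

text \<open>In \<open>\<bar>a - b\<bar> = a + b - 2 * min a b\<close> the integrals of
  \<open>a\<close> and \<open>b\<close> do not change under measure-preserving pullback, so a larger
  integral of the minimum means a smaller L1 distance.\<close>

lemma L1_dist_le_coupling:
  assumes N: "(N, \<phi>, \<psi>) \<in> couplings M M"
    and W1: "monotone_kernel M r W1" and W2: "monotone_kernel M r W2"
  shows "L1_dist (M \<Otimes>\<^sub>M M) W1 W2 \<le> L1_norm (N \<Otimes>\<^sub>M N) (\<lambda>z. pullback \<phi> W1 z - pullback \<psi> W2 z)"
proof -
  note mp = couplingsD(1,2)[OF N] couplingsD(1,3)[OF N]
  note int = monotone_kernel_integrable[OF W1] monotone_kernel_integrable[OF W2]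
  note intN = integrable_pullback[OF mp(1,2) int(1)] integrable_pullback[OF mp(3,4) int(2)]
  have abs_min: "\<bar>a - b\<bar> = a + b - 2 * min a b" for a b :: real by (auto simp: min_def)
  have space: "\<phi> s \<in> space M" "\<psi> s \<in> space M" if "s \<in> space N" for s
    using measurable_space[OF couplingsD(4)[OF N] that] measurable_space[OF couplingsD(5)[OF N] that]
    by auto
  have "(\<integral>z. min (pullback \<phi> W1 z) (pullback \<psi> W2 z) \<partial>(N \<Otimes>\<^sub>M N)) \<le>
      (\<integral>z. min (W1 z) (W2 z) \<partial>(M \<Otimes>\<^sub>M M))"
  proof -
    have "AE z in N \<Otimes>\<^sub>M N. 0 \<le> min (pullback \<phi> W1 z) (pullback \<psi> W2 z)"
      by (rule AE_I2) (auto simp: space_pair_measure pullback_def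
            intro!: monotone_kernelD(2)[OF W1] monotone_kernelD(2)[OF W2] space)
    moreover have nn: "AE z in M \<Otimes>\<^sub>M M. 0 \<le> min (W1 z) (W2 z)"
      by (rule AE_I2) (auto simp: space_pair_measure
            intro!: monotone_kernelD(2)[OF W1] monotone_kernelD(2)[OF W2])
    ultimately have "ennreal (\<integral>z. min (pullback \<phi> W1 z) (pullback \<psi> W2 z) \<partial>(N \<Otimes>\<^sub>M N)) \<le>
        ennreal (\<integral>z. min (W1 z) (W2 z) \<partial>(M \<Otimes>\<^sub>M M))"
      using nn_integral_min_pullback_le[OF N W1 W2] int intN
      by (simp add: nn_integral_eq_integral)
    then show ?thesis
      using integral_nonneg_AE[OF nn] by (simp add: ennreal_le_iff)
  qed
  moreover have "(\<integral>z. \<bar>W1 z - W2 z\<bar> \<partial>(M \<Otimes>\<^sub>M M)) =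
      integral\<^sup>L (M \<Otimes>\<^sub>M M) W1 + integral\<^sup>L (M \<Otimes>\<^sub>M M) W2 - 2 * (\<integral>z. min (W1 z) (W2 z) \<partial>(M \<Otimes>\<^sub>M M))"
    unfolding abs_min using int by simp
  moreover have "(\<integral>z. \<bar>pullback \<phi> W1 z - pullback \<psi> W2 z\<bar> \<partial>(N \<Otimes>\<^sub>M N)) =
      integral\<^sup>L (N \<Otimes>\<^sub>M N) (pullback \<phi> W1) + integral\<^sup>L (N \<Otimes>\<^sub>M N) (pullback \<psi> W2) -
      2 * (\<integral>z. min (pullback \<phi> W1 z) (pullback \<psi> W2 z) \<partial>(N \<Otimes>\<^sub>M N))"
    unfolding abs_min using intN by simp
  moreover have "integral\<^sup>L (N \<Otimes>\<^sub>M N) (pullback \<phi> W1) = integral\<^sup>L (M \<Otimes>\<^sub>M M) W1"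
    "integral\<^sup>L (N \<Otimes>\<^sub>M N) (pullback \<psi> W2) = integral\<^sup>L (M \<Otimes>\<^sub>M M) W2"
    using int by (auto intro!: integral_pullback mp)
  ultimately show ?thesis
    unfolding L1_dist_def L1_norm_def by linarith
qed

lemma delta_1_eq_L1_dist:
  assumes W1: "monotone_kernel M r W1" and W2: "monotone_kernel M r W2"
  shows "delta_1 M M W1 W2 = L1_dist (M \<Otimes>\<^sub>M M) W1 W2"
proof (rule antisym)
  note int = monotone_kernel_integrable[OF W1] monotone_kernel_integrable[OF W2]
  \<comment> \<open>The diagonal coupling, realised on \<open>M\<close> itself. The infimum in
    \<open>delta_1\<close> runs over measures on the product type; \<open>delta_1_le\<close> allows
    a coupling on any type.\<close>
  have "(M, \<lambda>x. x, \<lambda>x. x) \<in> couplings M M"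
    by (auto simp: couplings_def measure_preserving_def prob_space_axioms)
  from delta_1_le[OF this int] show "delta_1 M M W1 W2 \<le> L1_dist (M \<Otimes>\<^sub>M M) W1 W2"
    by (simp add: L1_dist_def pullback_def)
  show "L1_dist (M \<Otimes>\<^sub>M M) W1 W2 \<le> delta_1 M M W1 W2"
    unfolding delta_1_def
  proof (rule cINF_greatest)
    show "couplings M M \<noteq> ({} :: (('a \<times> 'a) measure \<times> ('a \<times> 'a \<Rightarrow> 'a) \<times> ('a \<times> 'a \<Rightarrow> 'a)) set)"
      using couplings_nonempty[OF prob_space_axioms prob_space_axioms] by blast
  qed (auto intro: L1_dist_le_coupling[OF _ W1 W2])
qed

end


section \<open>Approximation by step kernels\<close>

lemma L1_dist_triangle:
  assumes "integrable M f" "integrable M g" "integrable M h"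
  shows "L1_dist M f h \<le> L1_dist M f g + L1_dist M g h"
proof -
  have "L1_dist M f h \<le> (\<integral>z. \<bar>f z - g z\<bar> + \<bar>g z - h z\<bar> \<partial>M)"
    unfolding L1_dist_def L1_norm_def by (rule integral_mono) (use assms in auto)
  also have "\<dots> = L1_dist M f g + L1_dist M g h"
    unfolding L1_dist_def L1_norm_def
    by (rule Bochner_Integration.integral_add) (use assms in auto)
  finally show ?thesis .
qed

lemma L1_dist_tendsto_0:
  fixes w :: "'a \<Rightarrow> real"
  assumes "\<And>n. s n \<in> borel_measurable M" "f \<in> borel_measurable M" "integrable M w"
    and "\<And>z. z \<in> space M \<Longrightarrow> (\<lambda>n. s n z) \<longlonglongrightarrow> f z"
    and "\<And>n z. z \<in> space M \<Longrightarrow> \<bar>s n z - f z\<bar> \<le> w z"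
  shows "(\<lambda>n. L1_dist M f (s n)) \<longlonglongrightarrow> 0"
proof -
  note [measurable] = assms(1,2)
  have "(\<lambda>n. \<integral>z. \<bar>f z - s n z\<bar> \<partial>M) \<longlonglongrightarrow> (\<integral>z. 0 \<partial>M)"
  proof (rule integral_dominated_convergence[OF _ _ assms(3)])
    show "AE z in M. (\<lambda>n. \<bar>f z - s n z\<bar>) \<longlonglongrightarrow> 0"
    proof (rule AE_I2)
      fix z assume "z \<in> space M"
      from tendsto_diff[OF tendsto_const assms(4)[OF this], of "f z"]
      show "(\<lambda>n. \<bar>f z - s n z\<bar>) \<longlonglongrightarrow> 0" by (intro tendsto_rabs_zero) simp
    qed
    show "AE z in M. norm \<bar>f z - s n z\<bar> \<le> w z" for n
      by (rule AE_I2) (use assms(5) in \<open>simp add: abs_minus_commute\<close>)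
  qed simp_all
  then show ?thesis by (simp add: L1_dist_def L1_norm_def)
qed


text \<open>A finite measurable partition is encoded by a labelling \<open>p\<close> of the points, and a step
  kernel is \<open>pullback p h\<close> for a function \<open>h\<close> of two labels.\<close>

definition finite_labelling :: "'a measure \<Rightarrow> ('a \<Rightarrow> nat) \<Rightarrow> bool" where
  "finite_labelling M p \<longleftrightarrow> p \<in> measurable M (count_space UNIV) \<and> finite (range p)"

definition step_approximable :: "'a measure \<Rightarrow> ('a \<times> 'a \<Rightarrow> real) \<Rightarrow> bool" where
  "step_approximable M W \<longleftrightarrow>
    (\<forall>e>0. \<exists>p h. finite_labelling M p \<and> L1_dist (M \<Otimes>\<^sub>M M) W (pullback p h) < e)"

lemma finite_labelling_comp:
  "finite_labelling M p \<Longrightarrow> \<phi> \<in> measurable N M \<Longrightarrow> finite_labelling N (\<lambda>x. p (\<phi> x))"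
  unfolding finite_labelling_def
  by (auto intro: measurable_compose finite_subset[of "range (\<lambda>x. p (\<phi> x))" "range p"])

lemma finite_labelling_pair:
  assumes "finite_labelling M p" "finite_labelling M q"
  shows "finite_labelling M (\<lambda>x. prod_encode (p x, q x))"
proof -
  have [measurable]: "p \<in> measurable M (count_space UNIV)" "q \<in> measurable M (count_space UNIV)"
    using assms by (auto simp: finite_labelling_def)
  have "range (\<lambda>x. prod_encode (p x, q x)) \<subseteq> prod_encode ` (range p \<times> range q)" by auto
  moreover have "finite (prod_encode ` (range p \<times> range q))"
    using assms by (auto simp: finite_labelling_def)
  ultimately have "finite (range (\<lambda>x. prod_encode (p x, q x)))" by (rule finite_subset)
  then show ?thesis by (simp add: finite_labelling_def)
qed

lemma step_kernel_measurable:
  assumes "finite_labelling M p"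
  shows "pullback p h \<in> borel_measurable (M \<Otimes>\<^sub>M M)"
proof -
  have [measurable]: "p \<in> measurable M (count_space UNIV)"
    using assms by (auto simp: finite_labelling_def)
  have "(\<lambda>z. (p (fst z), p (snd z))) \<in> measurable (M \<Otimes>\<^sub>M M) (count_space UNIV \<Otimes>\<^sub>M count_space UNIV)"
    by measurable
  moreover have "h \<in> measurable (count_space UNIV \<Otimes>\<^sub>M count_space UNIV) borel"
    by (simp add: pair_measure_countable)
  ultimately have "(\<lambda>z. h (p (fst z), p (snd z))) \<in> borel_measurable (M \<Otimes>\<^sub>M M)"
    by (rule measurable_compose)
  then show ?thesis by (simp add: pullback_def split_beta')
qed

context prob_space
begin

lemma step_kernel_integrable:
  assumes "finite_labelling M p"
  shows "integrable (M \<Otimes>\<^sub>M M) (pullback p h)"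
proof -
  interpret P: pair_prob_space M M ..
  have "norm (pullback p h z) \<le> (\<Sum>k\<in>range p \<times> range p. \<bar>h k\<bar>)" for z
    using assms unfolding pullback_def real_norm_def
    by (cases z) (auto simp: finite_labelling_def intro!: member_le_sum[where f = "\<lambda>k. \<bar>h k\<bar>"])
  then show ?thesis
    by (intro P.integrable_const_bound[where B = "\<Sum>k\<in>range p \<times> range p. \<bar>h k\<bar>"]
        step_kernel_measurable assms AE_I2)
qed

lemma step_approximable_add:
  assumes int: "integrable (M \<Otimes>\<^sub>M M) V" "integrable (M \<Otimes>\<^sub>M M) W"
    and "step_approximable M V" "step_approximable M W"
  shows "step_approximable M (\<lambda>z. V z + W z)"
  unfolding step_approximable_def
proof (intro allI impI)
  fix e :: real assume "0 < e"
  then have "0 < e / 2" by simp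
  then obtain p h q k where ph: "finite_labelling M p" "L1_dist (M \<Otimes>\<^sub>M M) V (pullback p h) < e / 2"
    and qk: "finite_labelling M q" "L1_dist (M \<Otimes>\<^sub>M M) W (pullback q k) < e / 2"
    using assms(3,4) unfolding step_approximable_def by blast
  \<comment> \<open>The paired label describes the common refinement of both partitions;
    \<open>l\<close> decodes it and adds the two step values.\<close>
  define l where "l = (\<lambda>(i, j). h (fst (prod_decode i), fst (prod_decode j)) +
    k (snd (prod_decode i), snd (prod_decode j)))"
  have l: "pullback (\<lambda>x. prod_encode (p x, q x)) l = (\<lambda>z. pullback p h z + pullback q k z)"
    by (auto simp: pullback_def l_def fun_eq_iff)
  note ints = int step_kernel_integrable[OF ph(1), of h] step_kernel_integrable[OF qk(1), of k]
  have "L1_dist (M \<Otimes>\<^sub>M M) (\<lambda>z. V z + W z) (\<lambda>z. pullback p h z + pullback q k z) \<le>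
      (\<integral>z. \<bar>V z - pullback p h z\<bar> + \<bar>W z - pullback q k z\<bar> \<partial>(M \<Otimes>\<^sub>M M))"
    unfolding L1_dist_def L1_norm_def
    using ints by (intro integral_mono) auto
  also have "\<dots> = L1_dist (M \<Otimes>\<^sub>M M) V (pullback p h) + L1_dist (M \<Otimes>\<^sub>M M) W (pullback q k)"
    unfolding L1_dist_def L1_norm_def
    using ints by (intro Bochner_Integration.integral_add) auto
  also have "\<dots> < e" using ph(2) qk(2) by simp
  finally show "\<exists>p h. finite_labelling M p \<and>
      L1_dist (M \<Otimes>\<^sub>M M) (\<lambda>z. V z + W z) (pullback p h) < e"
    using finite_labelling_pair[OF ph(1) qk(1)] l by metis
qed

lemma step_approximable_scale:
  assumes "step_approximable M W"
  shows "step_approximable M (\<lambda>z. c * W z)"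
  unfolding step_approximable_def
proof (intro allI impI)
  fix e :: real assume "0 < e"
  then have "0 < e / (\<bar>c\<bar> + 1)" by simp
  then obtain p h where ph: "finite_labelling M p" "L1_dist (M \<Otimes>\<^sub>M M) W (pullback p h) < e / (\<bar>c\<bar> + 1)"
    using assms unfolding step_approximable_def by blast
  have nn: "0 \<le> L1_dist (M \<Otimes>\<^sub>M M) W (pullback p h)"
    by (simp add: L1_dist_def L1_norm_def)
  have "L1_dist (M \<Otimes>\<^sub>M M) (\<lambda>z. c * W z) (pullback p (\<lambda>k. c * h k)) =
      (\<integral>z. \<bar>c\<bar> * \<bar>W z - pullback p h z\<bar> \<partial>(M \<Otimes>\<^sub>M M))"
    unfolding L1_dist_def L1_norm_def
    by (intro Bochner_Integration.integral_cong)
       (auto simp: pullback_def right_diff_distrib[symmetric] abs_mult)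
  also have "\<dots> = \<bar>c\<bar> * L1_dist (M \<Otimes>\<^sub>M M) W (pullback p h)"
    by (simp add: L1_dist_def L1_norm_def)
  also have "\<dots> \<le> (\<bar>c\<bar> + 1) * L1_dist (M \<Otimes>\<^sub>M M) W (pullback p h)"
    using nn by (intro mult_right_mono) auto
  also have "\<dots> < e" using ph(2) by (simp add: pos_less_divide_eq mult.commute)
  finally show "\<exists>p h. finite_labelling M p \<and>
      L1_dist (M \<Otimes>\<^sub>M M) (\<lambda>z. c * W z) (pullback p h) < e"
    using ph(1) by blast
qed

lemma step_approximable_limit:
  assumes s: "\<And>n. integrable (M \<Otimes>\<^sub>M M) (s n)" "\<And>n. step_approximable M (s n)"
    and W: "integrable (M \<Otimes>\<^sub>M M) W" and lim: "(\<lambda>n. L1_dist (M \<Otimes>\<^sub>M M) W (s n)) \<longlonglongrightarrow> 0"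
  shows "step_approximable M W"
  unfolding step_approximable_def
proof (intro allI impI)
  fix e :: real assume "0 < e"
  then have e: "0 < e / 2" by simp
  have "\<forall>\<^sub>F n in sequentially. L1_dist (M \<Otimes>\<^sub>M M) W (s n) < e / 2"
    using order_tendstoD(2)[OF lim e] .
  then obtain n where n: "L1_dist (M \<Otimes>\<^sub>M M) W (s n) < e / 2"
    by (auto simp: eventually_sequentially)
  obtain p h where ph: "finite_labelling M p" "L1_dist (M \<Otimes>\<^sub>M M) (s n) (pullback p h) < e / 2"
    using s(2)[of n] e unfolding step_approximable_def by blast
  have "L1_dist (M \<Otimes>\<^sub>M M) W (pullback p h) < e"
    using L1_dist_triangle[OF W s(1)[of n] step_kernel_integrable[OF ph(1), of h]] n ph(2) by simp
  then show "\<exists>p h. finite_labelling M p \<and> L1_dist (M \<Otimes>\<^sub>M M) W (pullback p h) < e"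
    using ph(1) by blast
qed

lemma step_approximable_rectangle:
  assumes [measurable]: "A \<in> sets M" "B \<in> sets M"
  shows "step_approximable M (indicator (A \<times> B))"
  unfolding step_approximable_def
proof (intro allI impI)
  fix e :: real assume "0 < e"
  \<comment> \<open>One labelling serves both coordinates, so it must record membership in
    \<open>A\<close> and in \<open>B\<close> at once: 1 is contributed by \<open>A\<close> and 2 by
    \<open>B\<close>. \<open>?h\<close> reads the first from the row label and the second from the
    column label.\<close>
  let ?p = "\<lambda>x. if x \<in> A then if x \<in> B then 3 else 1 else if x \<in> B then 2 else 0 :: nat"
  let ?h = "\<lambda>(i, j). if i \<in> {1, 3} \<and> j \<in> {2, 3} then 1 else 0 :: real"
  have "range ?p \<subseteq> {0, 1, 2, 3}" by auto
  then have "finite (range ?p)" by (rule finite_subset) simp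
  then have "finite_labelling M ?p" by (simp add: finite_labelling_def)
  moreover have "pullback ?p ?h = indicator (A \<times> B)"
    by (auto simp: pullback_def fun_eq_iff split: split_indicator)
  ultimately show "\<exists>p h. finite_labelling M p \<and>
      L1_dist (M \<Otimes>\<^sub>M M) (indicator (A \<times> B)) (pullback p h) < e"
    using \<open>0 < e\<close> by (intro exI[of _ ?p] exI[of _ ?h]) (simp add: L1_dist_def L1_norm_def)
qed

lemma step_approximable_cong:
  assumes "step_approximable M V" "\<And>z. z \<in> space (M \<Otimes>\<^sub>M M) \<Longrightarrow> V z = W z"
  shows "step_approximable M W"
proof -
  have "L1_dist (M \<Otimes>\<^sub>M M) V U = L1_dist (M \<Otimes>\<^sub>M M) W U" for U
    unfolding L1_dist_def L1_norm_def
    by (rule Bochner_Integration.integral_cong) (simp_all add: assms(2))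
  then show ?thesis using assms(1) by (simp add: step_approximable_def)
qed

text \<open>Rectangles form an intersection-stable generator. Complements are handled by linearity,
  disjoint countable unions by dominated convergence of the partial sums; disjointness keeps these
  sums below 1.\<close>

lemma step_approximable_indicator:
  assumes "A \<in> sets (M \<Otimes>\<^sub>M M)"
  shows "step_approximable M (indicator A)"
proof -
  interpret P: pair_prob_space M M ..
  have int: "integrable (M \<Otimes>\<^sub>M M) (indicator A :: _ \<Rightarrow> real)" if "A \<in> sets (M \<Otimes>\<^sub>M M)" for A
    using that by (auto simp: integrable_indicator_iff P.emeasure_eq_measure)
  let ?G = "{a \<times> b | a b. a \<in> sets M \<and> b \<in> sets M}" and ?\<Omega> = "space M \<times> space M"
  have sets: "sets (M \<Otimes>\<^sub>M M) = sigma_sets ?\<Omega> ?G" by (rule sets_pair_measure)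
  have "A \<in> sigma_sets ?\<Omega> ?G" using assms by (simp add: sets)
  with Int_stable_pair_measure_generator pair_measure_closed show ?thesis
  proof (induction rule: sigma_sets_induct_disjoint)
    case (basic A)
    then show ?case using step_approximable_rectangle by auto
  next
    case empty
    show ?case using step_approximable_rectangle[of "{}" "{}"] by (simp add: indicator_def[abs_def])
  next
    case (compl A)
    have A: "A \<in> sets (M \<Otimes>\<^sub>M M)" using compl by (simp add: sets)
    have "?\<Omega> \<in> sets (M \<Otimes>\<^sub>M M)" by simp
    have "step_approximable M (\<lambda>z. indicator ?\<Omega> z + (- 1) * indicator A z)"
      using int[OF A] int[OF \<open>?\<Omega> \<in> _\<close>] compl(2)
      by (intro step_approximable_add step_approximable_scale step_approximable_rectangle) auto
    then show ?case
      by (rule step_approximable_cong)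
         (auto split: split_indicator simp: space_pair_measure)
  next
    case (union A)
    have A: "A i \<in> sets (M \<Otimes>\<^sub>M M)" for i using union by (auto simp: sets)
    let ?s = "\<lambda>n z. \<Sum>i<n. indicator (A i) z :: real"
    have s_int: "integrable (M \<Otimes>\<^sub>M M) (?s n)" for n using int A by auto
    have s_approx: "step_approximable M (?s n)" for n
    proof (induction n)
      case 0
      show ?case
        using step_approximable_rectangle[of "{}" "{}"] by (simp add: indicator_def[abs_def])
    next
      case (Suc n)
      then show ?case
        using step_approximable_add[OF s_int[of n] int[OF A[of n]] Suc union(3)] by simp
    qed
    have disj: "i \<noteq> j \<Longrightarrow> A i \<inter> A j = {}" for i j
      using union(1) by (auto simp: disjoint_family_on_def)
    have sums: "(\<lambda>n. ?s n z) \<longlonglongrightarrow> indicator (\<Union>i. A i) z" for z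
      using indicator_sums[of A z] disj by (simp add: sums_def)
    have s_bounds: "0 \<le> ?s n z" "?s n z \<le> 1" for n z
    proof -
      show "0 \<le> ?s n z" by (simp add: sum_nonneg)
      have "?s n z \<le> indicator (\<Union>i. A i) z"
        by (rule incseq_le[OF incseq_SucI sums]) simp
      then show "?s n z \<le> 1" by (rule order_trans) (simp add: indicator_le_1)
    qed
    have "(\<lambda>n. L1_dist (M \<Otimes>\<^sub>M M) (indicator (\<Union>i. A i)) (?s n)) \<longlonglongrightarrow> 0"
    proof (rule L1_dist_tendsto_0[where w = "\<lambda>_. 1"])
      show "\<bar>?s n z - indicator (\<Union>i. A i) z\<bar> \<le> 1" for n z
      proof -
        have "0 \<le> ?s n z" "?s n z \<le> 1" by (rule s_bounds)+
        then show ?thesis by (simp add: abs_le_iff indicator_def)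
      qed
    next
      show "(\<lambda>n. ?s n z) \<longlonglongrightarrow> indicator (\<Union>i. A i) z" for z by (rule sums)
    qed (use A in simp_all)
    then show ?case
      using A by (intro step_approximable_limit[OF s_int s_approx] int) auto
  qed
qed

lemma integrable_step_approximable:
  assumes "integrable (M \<Otimes>\<^sub>M M) W"
  shows "step_approximable M W"
  using assms
proof (induction rule: integrable_induct)
  case (base A c)
  show ?case
    using step_approximable_scale[OF step_approximable_indicator[OF base(1)], of c]
    by (simp add: mult.commute)
next
  case (add f g)
  then show ?case by (intro step_approximable_add)
next
  case (lim f s)
  \<comment> \<open>The approximating functions satisfy
    \<open>\<bar>s n z\<bar> \<le> 2 * \<bar>f z\<bar>\<close>, whence the dominating factor 3 for
    the difference.\<close>
  have L1_lim: "(\<lambda>n. L1_dist (M \<Otimes>\<^sub>M M) f (s n)) \<longlonglongrightarrow> 0"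
  proof (rule L1_dist_tendsto_0[where w = "\<lambda>z. 3 * \<bar>f z\<bar>"])
    show "\<bar>s n z - f z\<bar> \<le> 3 * \<bar>f z\<bar>" if "z \<in> space (M \<Otimes>\<^sub>M M)" for n z
      using lim.hyps(3)[OF that, of n] unfolding real_norm_def by linarith
  qed (use lim in auto)
  show ?case by (rule step_approximable_limit[OF _ _ _ L1_lim]) (use lim in auto)
qed

end


section \<open>The cut norm controls the \<open>L\<^sup>1\<close> norm\<close>

text \<open>A step kernel is a finite combination, with coefficients \<open>h\<close>, of products
  of indicators of label classes, and each such product is an admissible pair of test functions for
  the cut norm.\<close>

lemma integral_step_kernel_le_cut_norm:
  assumes D: "integrable (N \<Otimes>\<^sub>M N) D" and p: "finite_labelling N p"
  shows "\<bar>\<integral>z. D z * pullback p h z \<partial>(N \<Otimes>\<^sub>M N)\<bar> \<le> (\<Sum>k\<in>range p \<times> range p. \<bar>h k\<bar>) * cut_norm N D"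
proof -
  let ?f = "\<lambda>i x. if p x = i then 1 else 0 :: real"
  have [measurable]: "p \<in> measurable N (count_space UNIV)" and fin: "finite (range p)"
    using p by (auto simp: finite_labelling_def)
  note [measurable] = borel_measurable_integrable[OF D]
  have int: "integrable (N \<Otimes>\<^sub>M N) (\<lambda>(x, y). D (x, y) * ?f i x * ?f j y)" for i j
    by (rule Bochner_Integration.integrable_bound[OF D]) auto
  have "D z * pullback p h z =
      (\<Sum>k\<in>range p \<times> range p. h k * (case z of (x, y) \<Rightarrow> D (x, y) * ?f (fst k) x * ?f (snd k) y))"
    (is "_ = (\<Sum>k\<in>_. ?g k)") for z
  proof -
    obtain x y where z: "z = (x, y)" by (cases z)
    have "(\<Sum>k\<in>range p \<times> range p. ?g k) = (\<Sum>k\<in>{(p x, p y)}. ?g k)"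
      using fin by (intro sum.mono_neutral_right) (auto simp: z)
    then show ?thesis by (simp add: z pullback_def)
  qed
  then have "(\<integral>z. D z * pullback p h z \<partial>(N \<Otimes>\<^sub>M N)) = (\<Sum>k\<in>range p \<times> range p.
      h k * (\<integral>(x, y). D (x, y) * ?f (fst k) x * ?f (snd k) y \<partial>(N \<Otimes>\<^sub>M N)))"
    using int by simp
  also have "\<bar>\<dots>\<bar> \<le> (\<Sum>k\<in>range p \<times> range p. \<bar>h k\<bar> * cut_norm N D)"
  proof (rule order_trans[OF sum_abs sum_mono])
    fix k
    have "\<bar>\<integral>(x, y). D (x, y) * ?f (fst k) x * ?f (snd k) y \<partial>(N \<Otimes>\<^sub>M N)\<bar> \<le> cut_norm N D"
      by (rule cut_norm_upper[OF D]) auto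
    then show "\<bar>h k * (\<integral>(x, y). D (x, y) * ?f (fst k) x * ?f (snd k) y \<partial>(N \<Otimes>\<^sub>M N))\<bar> \<le>
        \<bar>h k\<bar> * cut_norm N D"
      unfolding abs_mult by (rule mult_left_mono) simp
  qed
  finally show ?thesis by (simp add: sum_distrib_right)
qed

text \<open>Testing the difference \<open>D\<close> of two kernels against step kernels close to each of them bounds
  \<open>\<integral>D\<^sup>2\<close> by the cut norm.\<close>

lemma (in prob_space) L1_norm_pullback_diff_le_cut_norm:
  assumes W1: "sym_kernel M W1" and W2: "sym_kernel M W2" and "0 < e"
  obtains K where "\<And>(N :: 'c measure) \<phi> \<psi>. (N, \<phi>, \<psi>) \<in> couplings M M \<Longrightarrow>
    (L1_norm (N \<Otimes>\<^sub>M N) (\<lambda>z. pullback \<phi> W1 z - pullback \<psi> W2 z))\<^sup>2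
      \<le> e + K * cut_norm N (\<lambda>z. pullback \<phi> W1 z - pullback \<psi> W2 z)"
proof -
  note int = sym_kernel_integrable[OF W1] sym_kernel_integrable[OF W2]
  have "0 < e / 2" using \<open>0 < e\<close> by simp
  then obtain p h q k where
    ph: "finite_labelling M p" "L1_dist (M \<Otimes>\<^sub>M M) W1 (pullback p h) < e / 2" and
    qk: "finite_labelling M q" "L1_dist (M \<Otimes>\<^sub>M M) W2 (pullback q k) < e / 2"
    using integrable_step_approximable[OF int(1)] integrable_step_approximable[OF int(2)]
    unfolding step_approximable_def by blast
  \<comment> \<open>Chosen before any coupling is given, so that the bound can be combined with an
    infimum over couplings.\<close>
  define K where "K = (\<Sum>i\<in>range p \<times> range p. \<bar>h i\<bar>) + (\<Sum>i\<in>range q \<times> range q. \<bar>k i\<bar>)"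
  show thesis
  proof (rule that[of K])
    fix N :: "'c measure" and \<phi> \<psi> assume N: "(N, \<phi>, \<psi>) \<in> couplings M M"
    interpret N: prob_space N by (rule couplingsD[OF N])
    interpret NN: pair_prob_space N N ..
    note mp = couplingsD(1,2)[OF N] couplingsD(1,3)[OF N]
    define D where "D = (\<lambda>z. pullback \<phi> W1 z - pullback \<psi> W2 z)"
    have D_int: "integrable (N \<Otimes>\<^sub>M N) D"
      unfolding D_def by (rule integrable_coupling_diff[OF N int])
    note [measurable] = borel_measurable_integrable[OF D_int]
    have D_le: "\<bar>D z\<bar> \<le> 1" if z_space: "z \<in> space (N \<Otimes>\<^sub>M N)" for z
    proof -
      obtain s t where z: "z = (s, t)" "s \<in> space N" "t \<in> space N"
        using z_space by (auto simp: space_pair_measure)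
      then have "\<phi> s \<in> space M" "\<phi> t \<in> space M" "\<psi> s \<in> space M" "\<psi> t \<in> space M"
        using measurable_space[OF couplingsD(4)[OF N]] measurable_space[OF couplingsD(5)[OF N]]
        by auto
      then have "W1 (\<phi> s, \<phi> t) \<in> {0..1}" "W2 (\<psi> s, \<psi> t) \<in> {0..1}"
        using W1 W2 by (auto simp: sym_kernel_def)
      then show ?thesis by (auto simp: D_def z pullback_def abs_le_iff)
    qed
    have test: "\<bar>\<integral>z. D z * pullback \<theta> W z \<partial>(N \<Otimes>\<^sub>M N)\<bar> \<le>
        L1_dist (M \<Otimes>\<^sub>M M) W (pullback p h) + (\<Sum>i\<in>range p \<times> range p. \<bar>h i\<bar>) * cut_norm N D"
      "integrable (N \<Otimes>\<^sub>M N) (\<lambda>z. D z * pullback \<theta> W z)"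
      if \<theta>: "measure_preserving N M \<theta>" and W: "integrable (M \<Otimes>\<^sub>M M) W"
        and p: "finite_labelling M p" for \<theta> W p h
    proof -
      have \<theta>m: "\<theta> \<in> measurable N M" using \<theta> by (simp add: measure_preserving_def)
      note p' = finite_labelling_comp[OF p \<theta>m]
      let ?S = "pullback (\<lambda>x. p (\<theta> x)) h"
      have S: "?S = pullback \<theta> (pullback p h)" by (auto simp: pullback_def)
      note ints = integrable_pullback[OF N.prob_space_axioms \<theta> W] N.step_kernel_integrable[OF p', of h]
      have prod_int: "integrable (N \<Otimes>\<^sub>M N) (\<lambda>z. D z * f z)"
        if "integrable (N \<Otimes>\<^sub>M N) f" for f :: "'c \<times> 'c \<Rightarrow> real"
      proof (rule Bochner_Integration.integrable_bound[OF that])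
        show "AE z in N \<Otimes>\<^sub>M N. norm (D z * f z) \<le> norm (f z)"
          by (rule AE_I2) (use D_le in \<open>auto simp: abs_mult intro: mult_left_le_one_le\<close>)
      qed (use that in auto)
      show "integrable (N \<Otimes>\<^sub>M N) (\<lambda>z. D z * pullback \<theta> W z)" by (rule prod_int[OF ints(1)])
      have diff_int: "integrable (N \<Otimes>\<^sub>M N) (\<lambda>z. pullback \<theta> W z - ?S z)" using ints by auto
      have "(\<integral>z. D z * pullback \<theta> W z \<partial>(N \<Otimes>\<^sub>M N)) =
          (\<integral>z. D z * (pullback \<theta> W z - ?S z) + D z * ?S z \<partial>(N \<Otimes>\<^sub>M N))"
        by (simp add: algebra_simps)
      also have "\<dots> = (\<integral>z. D z * (pullback \<theta> W z - ?S z) \<partial>(N \<Otimes>\<^sub>M N)) + (\<integral>z. D z * ?S z \<partial>(N \<Otimes>\<^sub>M N))"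
        by (intro Bochner_Integration.integral_add prod_int diff_int ints)
      finally have "\<bar>\<integral>z. D z * pullback \<theta> W z \<partial>(N \<Otimes>\<^sub>M N)\<bar> \<le>
          \<bar>\<integral>z. D z * (pullback \<theta> W z - ?S z) \<partial>(N \<Otimes>\<^sub>M N)\<bar> + \<bar>\<integral>z. D z * ?S z \<partial>(N \<Otimes>\<^sub>M N)\<bar>"
        by linarith
      moreover have "\<bar>\<integral>z. D z * (pullback \<theta> W z - ?S z) \<partial>(N \<Otimes>\<^sub>M N)\<bar> \<le>
          L1_dist (M \<Otimes>\<^sub>M M) W (pullback p h)"
      proof -
        have "\<bar>\<integral>z. D z * (pullback \<theta> W z - ?S z) \<partial>(N \<Otimes>\<^sub>M N)\<bar> \<le>
            (\<integral>z. \<bar>D z * (pullback \<theta> W z - ?S z)\<bar> \<partial>(N \<Otimes>\<^sub>M N))"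
          by (rule integral_abs_bound)
        also have "\<dots> \<le> (\<integral>z. \<bar>pullback \<theta> W z - ?S z\<bar> \<partial>(N \<Otimes>\<^sub>M N))"
          using D_le by (intro integral_mono integrable_abs prod_int diff_int)
            (auto simp: abs_mult intro: mult_left_le_one_le)
        also have "\<dots> = integral\<^sup>L (N \<Otimes>\<^sub>M N) (pullback \<theta> (\<lambda>z. \<bar>W z - pullback p h z\<bar>))"
          by (rule Bochner_Integration.integral_cong) (auto simp: pullback_def)
        also have "\<dots> = L1_dist (M \<Otimes>\<^sub>M M) W (pullback p h)"
          unfolding L1_dist_def L1_norm_def
          using W step_kernel_measurable[OF p, of h]
          by (intro integral_pullback[OF N.prob_space_axioms \<theta>]) auto
        finally show ?thesis .
      qed
      moreover have "\<bar>\<integral>z. D z * ?S z \<partial>(N \<Otimes>\<^sub>M N)\<bar> \<le>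
          (\<Sum>i\<in>range p \<times> range p. \<bar>h i\<bar>) * cut_norm N D"
      proof -
        have "\<bar>\<integral>z. D z * ?S z \<partial>(N \<Otimes>\<^sub>M N)\<bar> \<le>
            (\<Sum>i\<in>range (\<lambda>x. p (\<theta> x)) \<times> range (\<lambda>x. p (\<theta> x)). \<bar>h i\<bar>) * cut_norm N D"
          by (rule integral_step_kernel_le_cut_norm[OF D_int p'])
        \<comment> \<open>The composition with \<open>\<theta>\<close> may attain fewer labels than
          \<open>p\<close>. Summing over all labels of \<open>p\<close> makes the factor independent
          of the coupling.\<close>
        also have "\<dots> \<le> (\<Sum>i\<in>range p \<times> range p. \<bar>h i\<bar>) * cut_norm N D"
          using p by (intro mult_right_mono sum_mono2 cut_norm_nonneg D_int)
            (auto simp: finite_labelling_def)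
        finally show ?thesis .
      qed
      ultimately show "\<bar>\<integral>z. D z * pullback \<theta> W z \<partial>(N \<Otimes>\<^sub>M N)\<bar> \<le>
        L1_dist (M \<Otimes>\<^sub>M M) W (pullback p h) + (\<Sum>i\<in>range p \<times> range p. \<bar>h i\<bar>) * cut_norm N D"
        by linarith
    qed
    note t1 = test(1)[OF mp(2) int(1) ph(1), of h] test(2)[OF mp(2) int(1) ph(1)]
      and t2 = test(1)[OF mp(4) int(2) qk(1), of k] test(2)[OF mp(4) int(2) qk(1)]
    have "(L1_norm (N \<Otimes>\<^sub>M N) D)\<^sup>2 \<le> (\<integral>z. (D z)\<^sup>2 \<partial>(N \<Otimes>\<^sub>M N))"
    proof -
      have sq: "integrable (N \<Otimes>\<^sub>M N) (\<lambda>z. \<bar>D z\<bar>\<^sup>2)"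
        by (rule NN.integrable_const_bound[where B = 1])
           (use D_le in \<open>auto intro!: AE_I2 simp: abs_square_le_1\<close>)
      \<comment> \<open>Nonnegative variance is the Cauchy-Schwarz bound of the squared L1 norm by
        the integral of the square on a probability space.\<close>
      have "0 \<le> NN.variance (\<lambda>z. \<bar>D z\<bar>)" by simp
      also have "\<dots> = NN.expectation (\<lambda>z. \<bar>D z\<bar>\<^sup>2) - (NN.expectation (\<lambda>z. \<bar>D z\<bar>))\<^sup>2"
        by (rule NN.variance_eq) (use D_int sq in auto)
      finally show ?thesis by (simp add: L1_norm_def)
    qed
    also have "(\<integral>z. (D z)\<^sup>2 \<partial>(N \<Otimes>\<^sub>M N)) =
        (\<integral>z. D z * pullback \<phi> W1 z - D z * pullback \<psi> W2 z \<partial>(N \<Otimes>\<^sub>M N))"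
      by (rule Bochner_Integration.integral_cong) (auto simp: D_def power2_eq_square right_diff_distrib)
    also have "\<dots> = (\<integral>z. D z * pullback \<phi> W1 z \<partial>(N \<Otimes>\<^sub>M N)) - (\<integral>z. D z * pullback \<psi> W2 z \<partial>(N \<Otimes>\<^sub>M N))"
      by (rule Bochner_Integration.integral_diff[OF t1(2) t2(2)])
    also have "\<dots> \<le> e + K * cut_norm N D"
      using t1(1) t2(1) ph(2) qk(2) unfolding K_def distrib_right by linarith
    finally show "(L1_norm (N \<Otimes>\<^sub>M N) (\<lambda>z. pullback \<phi> W1 z - pullback \<psi> W2 z))\<^sup>2
      \<le> e + K * cut_norm N (\<lambda>z. pullback \<phi> W1 z - pullback \<psi> W2 z)"
      by (simp add: D_def)
  qed
qed

text \<open>No coupling is assumed to attain the infimum. Couplings of small cut norm have small L1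
  norm by the uniform factor \<open>K\<close>, and each of these L1 norms is at least that of the
  diagonal.\<close>

lemma (in ordered_prob_space) L1_dist_0_if_delta_cut_0:
  assumes W1: "monotone_kernel M r W1" and W2: "monotone_kernel M r W2"
    and zero: "delta_cut M M W1 W2 = 0"
  shows "L1_dist (M \<Otimes>\<^sub>M M) W1 W2 = 0"
proof -
  have sym: "sym_kernel M W1" "sym_kernel M W2" using W1 W2 by (auto simp: monotone_kernel_def)
  note int = sym_kernel_integrable[OF sym(1)] sym_kernel_integrable[OF sym(2)]
  have nn: "0 \<le> L1_dist (M \<Otimes>\<^sub>M M) W1 W2" by (simp add: L1_dist_def L1_norm_def)
  have "(L1_dist (M \<Otimes>\<^sub>M M) W1 W2)\<^sup>2 \<le> e" if "0 < e" for e
  proof -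
    have "0 < e / 2" using that by simp
    then obtain K where K: "\<And>(N :: ('a \<times> 'a) measure) \<phi> \<psi>. (N, \<phi>, \<psi>) \<in> couplings M M \<Longrightarrow>
      (L1_norm (N \<Otimes>\<^sub>M N) (\<lambda>z. pullback \<phi> W1 z - pullback \<psi> W2 z))\<^sup>2
        \<le> e / 2 + K * cut_norm N (\<lambda>z. pullback \<phi> W1 z - pullback \<psi> W2 z)"
      using L1_norm_pullback_diff_le_cut_norm[OF sym] by blast
    \<comment> \<open>\<open>K\<close> comes without a sign; \<open>\<bar>K\<bar> + 1\<close>
      dominates it and is a positive denominator.\<close>
    have "delta_cut M M W1 W2 < e / (2 * (\<bar>K\<bar> + 1))" using zero that by simp
    then obtain N :: "('a \<times> 'a) measure" and \<phi> \<psi> where N: "(N, \<phi>, \<psi>) \<in> couplings M M"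
      and cut: "cut_norm N (\<lambda>z. pullback \<phi> W1 z - pullback \<psi> W2 z) < e / (2 * (\<bar>K\<bar> + 1))"
      (is "?c < _")
      unfolding delta_cut_def
      using couplings_nonempty[OF prob_space_axioms prob_space_axioms]
      by (subst (asm) cINF_less_iff)
         (auto intro!: bdd_belowI2[where m = 0] cut_norm_nonneg integrable_coupling_diff int)
    have c: "0 \<le> ?c" by (intro cut_norm_nonneg integrable_coupling_diff[OF N int])
    have "(L1_dist (M \<Otimes>\<^sub>M M) W1 W2)\<^sup>2 \<le>
        (L1_norm (N \<Otimes>\<^sub>M N) (\<lambda>z. pullback \<phi> W1 z - pullback \<psi> W2 z))\<^sup>2"
      by (intro power_mono L1_dist_le_coupling[OF N W1 W2] nn)
    also have "\<dots> \<le> e / 2 + K * ?c" by (rule K[OF N])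
    also have "K * ?c \<le> (\<bar>K\<bar> + 1) * ?c" using c by (intro mult_right_mono) auto
    also have "(\<bar>K\<bar> + 1) * ?c \<le> e / 2"
      using cut by (simp add: field_simps)
    finally show ?thesis by simp
  qed
  then have "(L1_dist (M \<Otimes>\<^sub>M M) W1 W2)\<^sup>2 \<le> 0" by (rule field_le_epsilon[of _ 0, simplified])
  then show ?thesis by simp
qed


section \<open>The triangle inequality for \<open>\<delta>\<^sub>\<box>\<close>\<close>

lemma integrable_cut_test:
  assumes W: "integrable (M \<Otimes>\<^sub>M M) W"
    and f: "f \<in> borel_measurable M" "\<forall>x\<in>space M. f x \<in> {-1..1::real}"
    and g: "g \<in> borel_measurable M" "\<forall>x\<in>space M. g x \<in> {-1..1::real}"
  shows "integrable (M \<Otimes>\<^sub>M M) (\<lambda>(x, y). W (x, y) * f x * g y)"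
proof (rule Bochner_Integration.integrable_bound[OF W])
  note [measurable] = f(1) g(1) borel_measurable_integrable[OF W]
  show "(\<lambda>(x, y). W (x, y) * f x * g y) \<in> borel_measurable (M \<Otimes>\<^sub>M M)" by measurable
  have "\<bar>W (x, y)\<bar> * (\<bar>f x\<bar> * \<bar>g y\<bar>) \<le> \<bar>W (x, y)\<bar>" if "x \<in> space M" "y \<in> space M" for x y
  proof -
    have "\<bar>f x\<bar> \<le> 1" "\<bar>g y\<bar> \<le> 1" using f(2) g(2) that by (auto simp: abs_le_iff)
    then have "\<bar>f x\<bar> * \<bar>g y\<bar> \<le> 1" by (simp add: mult_le_one)
    then show ?thesis by (simp add: mult_left_le)
  qed
  then show "AE z in M \<Otimes>\<^sub>M M. norm (case z of (x, y) \<Rightarrow> W (x, y) * f x * g y) \<le> norm (W z)"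
    by (intro AE_I2) (auto simp: space_pair_measure abs_mult mult.assoc)
qed

lemma cut_norm_triangle:
  assumes V: "integrable (M \<Otimes>\<^sub>M M) V" and W: "integrable (M \<Otimes>\<^sub>M M) W"
  shows "cut_norm M (\<lambda>z. V z + W z) \<le> cut_norm M V + cut_norm M W"
proof (rule cut_norm_least)
  fix f g :: "'a \<Rightarrow> real"
  assume fg: "f \<in> borel_measurable M" "\<forall>x\<in>space M. f x \<in> {-1..1}"
    "g \<in> borel_measurable M" "\<forall>x\<in>space M. g x \<in> {-1..1}"
  have "(\<integral>(x, y). (V (x, y) + W (x, y)) * f x * g y \<partial>(M \<Otimes>\<^sub>M M)) =
      (\<integral>z. (case z of (x, y) \<Rightarrow> V (x, y) * f x * g y) + (case z of (x, y) \<Rightarrow> W (x, y) * f x * g y)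
        \<partial>(M \<Otimes>\<^sub>M M))"
    by (rule Bochner_Integration.integral_cong) (auto simp: algebra_simps)
  also have "\<dots> = (\<integral>(x, y). V (x, y) * f x * g y \<partial>(M \<Otimes>\<^sub>M M)) +
      (\<integral>(x, y). W (x, y) * f x * g y \<partial>(M \<Otimes>\<^sub>M M))"
    by (rule Bochner_Integration.integral_add) (intro integrable_cut_test V W fg)+
  finally show "\<bar>\<integral>(x, y). (V (x, y) + W (x, y)) * f x * g y \<partial>(M \<Otimes>\<^sub>M M)\<bar> \<le>
      cut_norm M V + cut_norm M W"
    using cut_norm_upper[OF V fg] cut_norm_upper[OF W fg] by linarith
qed

lemma cut_norm_minus: "cut_norm M (\<lambda>z. - W z) = cut_norm M W"
proof -
  have "(\<integral>(x, y). - W (x, y) * f x * g y \<partial>(M \<Otimes>\<^sub>M M)) = - (\<integral>(x, y). W (x, y) * f x * g y \<partial>(M \<Otimes>\<^sub>M M))"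
    for f g :: "'a \<Rightarrow> real"
    by (subst integral_minus[symmetric], rule Bochner_Integration.integral_cong) auto
  then show ?thesis by (simp add: cut_norm_def)
qed

lemma cut_norm_le_L1_norm:
  "integrable (M \<Otimes>\<^sub>M M) W \<Longrightarrow> cut_norm M W \<le> L1_norm (M \<Otimes>\<^sub>M M) W"
  by (rule cut_norm_least) (rule cut_norm_bdd)

text \<open>The function \<open>f'\<close> is the conditional expectation of \<open>f\<close> given \<open>\<phi>\<close>, as a function on the
  image space.\<close>

lemma ex_conditional_expectation_factor:
  fixes f :: "'c \<Rightarrow> real"
  assumes N: "prob_space N" and M: "prob_space M" and \<phi>: "measure_preserving N M \<phi>"
    and f: "f \<in> borel_measurable N" "\<forall>x\<in>space N. f x \<in> {-1..1}"
  obtains f' :: "'a \<Rightarrow> real" where "f' \<in> borel_measurable M" "\<forall>x\<in>space M. f' x \<in> {-1..1}"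
    "\<And>u :: 'a \<Rightarrow> real. integrable M u \<Longrightarrow> (\<integral>s. u (\<phi> s) * f s \<partial>N) = (\<integral>x. u x * f' x \<partial>M)"
proof -
  interpret N: prob_space N by fact
  interpret M: prob_space M by fact
  have [measurable]: "\<phi> \<in> measurable N M" and distr: "distr N M \<phi> = M"
    using \<phi> by (auto simp: measure_preserving_def)
  note [measurable] = f(1)
  \<comment> \<open>Rescaling from \<open>[-1, 1]\<close> to \<open>[0, 1]\<close> makes
    \<open>F\<close> the density of a measure dominated by \<open>N\<close>. Its image \<nu> is then
    dominated by \<open>M\<close>, and the Radon-Nikodym derivative of \<nu> is the conditional
    expectation of \<open>F\<close>.\<close>
  define F where "F s = (f s + 1) / 2" for s
  have [measurable]: "F \<in> borel_measurable N" unfolding F_def[abs_def] by measurable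
  have F: "0 \<le> F s" "F s \<le> 1" if "s \<in> space N" for s
    using f(2) that by (auto simp: F_def)
  define \<nu> where "\<nu> = distr (density N (\<lambda>s. ennreal (F s))) M \<phi>"
  have sets_\<nu>: "sets \<nu> = sets M" by (simp add: \<nu>_def)
  have \<nu>_le: "emeasure \<nu> A \<le> emeasure M A" if [measurable]: "A \<in> sets M" for A
  proof -
    have "emeasure \<nu> A = (\<integral>\<^sup>+s. ennreal (F s) * indicator (\<phi> -` A \<inter> space N) s \<partial>N)"
      by (simp add: \<nu>_def emeasure_distr emeasure_density)
    also have "\<dots> \<le> (\<integral>\<^sup>+s. indicator (\<phi> -` A \<inter> space N) s \<partial>N)"
      using F by (intro nn_integral_mono) (auto split: split_indicator)
    also have "\<dots> = emeasure (distr N M \<phi>) A" by (simp add: emeasure_distr)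
    finally show ?thesis by (simp add: distr)
  qed
  have "absolutely_continuous M \<nu>"
    unfolding absolutely_continuous_def
  proof
    fix A assume "A \<in> null_sets M"
    then show "A \<in> null_sets \<nu>" using \<nu>_le[of A] by (auto simp: null_sets_def sets_\<nu>)
  qed
  from M.Radon_Nikodym[OF this sets_\<nu>] obtain h :: "'a \<Rightarrow> ennreal"
    where [measurable]: "h \<in> borel_measurable M" and h: "density M h = \<nu>" by auto
  \<comment> \<open>If \<open>h\<close> exceeded 1 on a set of positive measure, \<nu> would give
    the set \<open>A\<close> where this happens more mass than \<open>M\<close> does, against
    \<open>\<nu>_le\<close>.\<close>
  have h_le: "AE x in M. h x \<le> 1"
  proof (rule ccontr)
    assume not: "\<not> (AE x in M. h x \<le> 1)"
    define A where "A = {x \<in> space M. 1 < h x}"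
    have [measurable]: "A \<in> sets M" unfolding A_def by measurable
    have "(\<integral>\<^sup>+x. indicator A x \<partial>M) < (\<integral>\<^sup>+x. h x * indicator A x \<partial>M)"
    proof (rule nn_integral_less)
      show "AE x in M. indicator A x \<le> h x * indicator A x"
        by (rule AE_I2) (auto simp: A_def split: split_indicator)
      show "\<not> (AE x in M. h x * indicator A x \<le> indicator A x)"
      proof
        assume "AE x in M. h x * indicator A x \<le> indicator A x"
        then have "AE x in M. h x \<le> 1"
          using AE_space
        proof eventually_elim
          case (elim x)
          then show ?case by (cases "1 < h x") (auto simp: A_def not_less)
        qed
        with not show False ..
      qed
    qed (simp_all add: M.emeasure_eq_measure)
    also have "\<dots> = emeasure \<nu> A" by (simp add: h[symmetric] emeasure_density)
    also have "\<dots> \<le> emeasure M A" by (rule \<nu>_le) simp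
    finally show False by simp
  qed
  \<comment> \<open>Test functions for the cut norm must be bounded at every point of the space,
    while \<open>h\<close> is bounded only almost everywhere; truncation changes it on a null
    set.\<close>
  define H where "H x = enn2real (min 1 (h x))" for x
  have [measurable]: "H \<in> borel_measurable M" unfolding H_def[abs_def] by measurable
  have H: "0 \<le> H x" "H x \<le> 1" for x
    unfolding H_def by (auto intro!: enn2real_leI)
  have "AE x in M. h x = ennreal (H x)"
    using h_le
  proof eventually_elim
    case (elim x)
    have "h x < \<top>" by (rule le_less_trans[OF elim]) simp
    then show ?case using elim by (simp add: H_def min_absorb2)
  qed
  then have density: "density M (\<lambda>x. ennreal (H x)) = \<nu>"
    unfolding h[symmetric] by (intro density_cong) auto
  have weighted: "(\<integral>s. F s * u (\<phi> s) \<partial>N) = (\<integral>x. H x * u x \<partial>M)"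
    if [measurable]: "u \<in> borel_measurable M" for u :: "'a \<Rightarrow> real"
  proof -
    have "(\<integral>s. F s * u (\<phi> s) \<partial>N) = integral\<^sup>L (density N (\<lambda>s. ennreal (F s))) (\<lambda>s. u (\<phi> s))"
      by (subst integral_density) (use F in \<open>auto intro!: AE_I2\<close>)
    also have "\<dots> = integral\<^sup>L \<nu> u"
      unfolding \<nu>_def by (rule integral_distr[symmetric]) auto
    also have "\<dots> = (\<integral>x. H x * u x \<partial>M)"
      unfolding density[symmetric] by (subst integral_density) (use H in auto)
    finally show ?thesis .
  qed
  show thesis
  proof (rule that[of "\<lambda>x. 2 * H x - 1"])
    show "\<forall>x\<in>space M. 2 * H x - 1 \<in> {-1..1}" using H by (simp add: algebra_simps)
    fix u :: "'a \<Rightarrow> real" assume u: "integrable M u"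
    note [measurable] = borel_measurable_integrable[OF u]
    have u': "integrable N (\<lambda>s. u (\<phi> s))"
      using u distr by (metis integrable_distr \<open>\<phi> \<in> measurable N M\<close>)
    have uF: "integrable N (\<lambda>s. F s * u (\<phi> s))"
      by (rule Bochner_Integration.integrable_bound[OF u'])
         (use F in \<open>auto intro!: AE_I2 mult_left_le_one_le simp: abs_mult\<close>)
    have uH: "integrable M (\<lambda>x. H x * u x)"
      by (rule Bochner_Integration.integrable_bound[OF u])
         (use H in \<open>auto intro!: AE_I2 mult_left_le_one_le simp: abs_mult\<close>)
    have "(\<integral>s. u (\<phi> s) * f s \<partial>N) = (\<integral>s. 2 * (F s * u (\<phi> s)) - u (\<phi> s) \<partial>N)"
      by (rule Bochner_Integration.integral_cong) (auto simp: F_def field_simps)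
    also have "\<dots> = 2 * (\<integral>s. F s * u (\<phi> s) \<partial>N) - (\<integral>s. u (\<phi> s) \<partial>N)"
      using uF u' by simp
    also have "(\<integral>s. u (\<phi> s) \<partial>N) = (\<integral>x. u x \<partial>M)"
      using integral_distr[of \<phi> N M u] by (simp add: distr)
    also have "2 * (\<integral>s. F s * u (\<phi> s) \<partial>N) - (\<integral>x. u x \<partial>M) = (\<integral>x. 2 * (H x * u x) - u x \<partial>M)"
      using uH u by (simp add: weighted)
    also have "\<dots> = (\<integral>x. u x * (2 * H x - 1) \<partial>M)"
      by (rule Bochner_Integration.integral_cong) (auto simp: algebra_simps)
    finally show "(\<integral>s. u (\<phi> s) * f s \<partial>N) = (\<integral>x. u x * (2 * H x - 1) \<partial>M)" .
  qed simp
qed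

text \<open>Test functions on \<open>N\<close> need not factor through \<phi>, but the integral sees
  only their conditional expectations given \<phi>, which are test functions on \<open>M\<close>.
  The two are averaged one after the other. Together with \<open>cut_norm_le_pullback\<close> this
  makes the cut norm invariant under pullback.\<close>

lemma cut_norm_pullback_le:
  assumes N: "prob_space N" and M: "prob_space M" and \<phi>: "measure_preserving N M \<phi>"
    and W: "integrable (M \<Otimes>\<^sub>M M) W"
  shows "cut_norm N (pullback \<phi> W) \<le> cut_norm M W"
proof (rule cut_norm_least)
  fix f g :: "'a \<Rightarrow> real"
  assume f: "f \<in> borel_measurable N" "\<forall>x\<in>space N. f x \<in> {-1..1}"
    and g: "g \<in> borel_measurable N" "\<forall>x\<in>space N. g x \<in> {-1..1}"
  interpret N: prob_space N by fact
  interpret M: prob_space M by fact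
  interpret NN: pair_sigma_finite N N ..
  interpret MM: pair_sigma_finite M M ..
  have \<phi>m [measurable]: "\<phi> \<in> measurable N M" and distr: "distr N M \<phi> = M"
    using \<phi> by (auto simp: measure_preserving_def)
  obtain f' where f': "f' \<in> borel_measurable M" "\<forall>x\<in>space M. f' x \<in> {-1..1}"
    "\<And>u. integrable M u \<Longrightarrow> (\<integral>s. u (\<phi> s) * f s \<partial>N) = (\<integral>x. u x * f' x \<partial>M)"
    using ex_conditional_expectation_factor[OF N M \<phi> f] by blast
  obtain g' where g': "g' \<in> borel_measurable M" "\<forall>x\<in>space M. g' x \<in> {-1..1}"
    "\<And>u. integrable M u \<Longrightarrow> (\<integral>s. u (\<phi> s) * g s \<partial>N) = (\<integral>x. u x * g' x \<partial>M)"
    using ex_conditional_expectation_factor[OF N M \<phi> g] by blast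
  note [measurable] = f(1) g(1) f'(1) g'(1) borel_measurable_integrable[OF W]
  \<comment> \<open>\<open>f'\<close> can be applied only to integrable sections, and these exist
    for almost every \<open>y\<close> in \<open>M\<close>; measure preservation moves this to almost
    every \<open>t\<close> in \<open>N\<close> with \<open>y = \<phi> t\<close>.\<close>
  have "AE y in M. integrable M (\<lambda>x. W (x, y))"
    by (rule MM.AE_integrable_snd) (use W in simp)
  then have "AE y in distr N M \<phi>. integrable M (\<lambda>x. W (x, y))" by (simp only: distr)
  then have AE_int: "AE t in N. integrable M (\<lambda>x. W (x, \<phi> t))"
    by (rule AE_distrD[OF \<phi>m])
  define w where "w y = (\<integral>x. W (x, y) * f' x \<partial>M)" for y
  have "integrable (M \<Otimes>\<^sub>M M) (\<lambda>(x, y). W (x, y) * f' x * 1)"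
    by (rule integrable_cut_test[OF W f'(1,2), of "\<lambda>_. 1"]) auto
  then have w_int: "integrable M w"
    unfolding w_def[abs_def] by (intro MM.integrable_snd) simp
  note [measurable] = borel_measurable_integrable[OF w_int]
  have "(\<integral>(s, t). pullback \<phi> W (s, t) * f s * g t \<partial>(N \<Otimes>\<^sub>M N)) =
      (\<integral>t. (\<integral>s. pullback \<phi> W (s, t) * f s * g t \<partial>N) \<partial>N)"
    by (rule NN.integral_snd[symmetric])
       (rule integrable_cut_test[OF integrable_pullback[OF N \<phi> W] f g])
  also have "\<dots> = (\<integral>t. w (\<phi> t) * g t \<partial>N)"
  proof (rule integral_cong_AE)
    show "AE t in N. (\<integral>s. pullback \<phi> W (s, t) * f s * g t \<partial>N) = w (\<phi> t) * g t"
      using AE_int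
    proof eventually_elim
      case (elim t)
      from f'(3)[OF elim] show ?case by (simp add: pullback_def w_def)
    qed
  qed (simp_all add: pullback_def)
  also have "\<dots> = (\<integral>y. w y * g' y \<partial>M)" by (rule g'(3)[OF w_int])
  also have "\<dots> = (\<integral>y. (\<integral>x. W (x, y) * f' x * g' y \<partial>M) \<partial>M)" by (simp add: w_def)
  also have "\<dots> = (\<integral>(x, y). W (x, y) * f' x * g' y \<partial>(M \<Otimes>\<^sub>M M))"
    by (rule MM.integral_snd) (rule integrable_cut_test[OF W f'(1,2) g'(1,2)])
  finally show "\<bar>\<integral>(s, t). pullback \<phi> W (s, t) * f s * g t \<partial>(N \<Otimes>\<^sub>M N)\<bar> \<le> cut_norm M W"
    using cut_norm_upper[OF W f'(1,2) g'(1,2)] by simp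
qed

lemma L1_norm_pullback:
  assumes "prob_space N" "measure_preserving N M \<phi>" "V \<in> borel_measurable (M \<Otimes>\<^sub>M M)"
  shows "L1_norm (N \<Otimes>\<^sub>M N) (pullback \<phi> V) = L1_norm (M \<Otimes>\<^sub>M M) V"
proof -
  have "L1_norm (N \<Otimes>\<^sub>M N) (pullback \<phi> V) = integral\<^sup>L (N \<Otimes>\<^sub>M N) (pullback \<phi> (\<lambda>z. \<bar>V z\<bar>))"
    unfolding L1_norm_def by (rule Bochner_Integration.integral_cong) (auto simp: pullback_def)
  also have "\<dots> = L1_norm (M \<Otimes>\<^sub>M M) V"
    unfolding L1_norm_def using assms by (intro integral_pullback) auto
  finally show ?thesis .
qed

section \<open>Gluing probability spaces along a label with countably many values\<close>

lemma sets_labels_eq: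
  fixes a b :: "'a \<Rightarrow> nat"
  assumes [measurable]: "a \<in> measurable N (count_space UNIV)" "b \<in> measurable N (count_space UNIV)"
  shows "{z \<in> space N. a z = b z} \<in> sets N"
proof -
  have "{z \<in> space N. a z = b z} = (\<Union>i. {z \<in> space N. a z = i \<and> b z = i})" by auto
  also have "\<dots> \<in> sets N" by measurable
  finally show ?thesis .
qed

text \<open>There are only countably many labels, so those of probability 0 occupy a null set
  altogether. In the gluing this confines the default value \<open>1 / 0 = 0\<close> to a null
  set.\<close>

lemma (in prob_space) AE_label_positive:
  fixes c :: "'a \<Rightarrow> nat"
  assumes [measurable]: "c \<in> measurable M (count_space UNIV)"
  shows "AE s in M. prob {t \<in> space M. c t = c s} \<noteq> 0"
proof -
  have "AE s in M. c s = i \<longrightarrow> prob {t \<in> space M. c t = i} \<noteq> 0" for i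
  proof (cases "prob {t \<in> space M. c t = i} = 0")
    case True
    then have "{t \<in> space M. c t = i} \<in> null_sets M"
      by (auto simp: null_sets_def emeasure_eq_measure)
    then have "AE s in M. c s \<noteq> i" by (subst AE_iff_null) auto
    then show ?thesis by eventually_elim simp
  qed simp
  then have "AE s in M. \<forall>i. c s = i \<longrightarrow> prob {t \<in> space M. c t = i} \<noteq> 0"
    unfolding AE_all_countable by blast
  then show ?thesis by eventually_elim simp
qed

text \<open>The two spaces are made conditionally independent given the common label, by the density
  \<open>1 / P (label = i)\<close> on the pairs whose labels are both \<open>i\<close>. Labels of probability \<open>0\<close> get the
  density \<open>1 / 0 = 0\<close>.\<close>

lemma glue_along_labels:
  fixes N1 :: "'c measure" and N2 :: "'d measure" and a :: "'c \<Rightarrow> nat" and b :: "'d \<Rightarrow> nat"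
  assumes N1: "prob_space N1" and N2: "prob_space N2"
    and a [measurable]: "a \<in> measurable N1 (count_space UNIV)"
    and b [measurable]: "b \<in> measurable N2 (count_space UNIV)"
    and eq: "\<And>i. measure N1 {s \<in> space N1. a s = i} = measure N2 {t \<in> space N2. b t = i}"
  obtains G :: "('c \<times> 'd) measure" where "prob_space G" "measure_preserving G N1 fst"
    "measure_preserving G N2 snd" "AE z in G. a (fst z) = b (snd z)"
proof -
  interpret N1: prob_space N1 by fact
  interpret N2: prob_space N2 by fact
  interpret P: pair_sigma_finite N1 N2 ..
  define m where "m i = measure N1 {s \<in> space N1. a s = i}" for i
  have m2: "measure N2 {t \<in> space N2. b t = i} = m i" for i by (simp add: m_def eq)
  define g where "g = (\<lambda>(s, t). if a s = b t then ennreal (1 / m (a s)) else 0)"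
  have g_measurable [measurable]: "g \<in> borel_measurable (N1 \<Otimes>\<^sub>M N2)"
    unfolding g_def split_beta'
  proof (rule measurable_If)
    have "(\<lambda>z. a (fst z)) \<in> measurable (N1 \<Otimes>\<^sub>M N2) (count_space UNIV)" by measurable
    then show "(\<lambda>z. ennreal (1 / m (a (fst z)))) \<in> borel_measurable (N1 \<Otimes>\<^sub>M N2)"
      by (rule measurable_compose) simp
    show "{z \<in> space (N1 \<Otimes>\<^sub>M N2). a (fst z) = b (snd z)} \<in> sets (N1 \<Otimes>\<^sub>M N2)"
      by (rule sets_labels_eq) measurable
  qed simp
  define G where "G = density (N1 \<Otimes>\<^sub>M N2) g"
  have weight: "ennreal (1 / m i) * ennreal (m i) = 1" if "m i \<noteq> 0" for i
    using that by (simp add: ennreal_mult[symmetric] m_def)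
  have inner2: "(\<integral>\<^sup>+t. g (s, t) \<partial>N2) = 1" if "m (a s) \<noteq> 0" for s
  proof -
    have "(\<integral>\<^sup>+t. g (s, t) \<partial>N2) = (\<integral>\<^sup>+t. ennreal (1 / m (a s)) * indicator {t \<in> space N2. b t = a s} t \<partial>N2)"
      by (rule nn_integral_cong) (auto simp: g_def split: split_indicator)
    also have "\<dots> = ennreal (1 / m (a s)) * ennreal (m (a s))"
      by (simp add: nn_integral_cmult N2.emeasure_eq_measure m2)
    finally show ?thesis by (simp only: weight[OF that])
  qed
  have inner1: "(\<integral>\<^sup>+s. g (s, t) \<partial>N1) = 1" if "m (b t) \<noteq> 0" for t
  proof -
    have "(\<integral>\<^sup>+s. g (s, t) \<partial>N1) = (\<integral>\<^sup>+s. ennreal (1 / m (b t)) * indicator {s \<in> space N1. a s = b t} s \<partial>N1)"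
      by (rule nn_integral_cong) (auto simp: g_def split: split_indicator)
    also have "\<dots> = ennreal (1 / m (b t)) * ennreal (m (b t))"
      by (simp add: nn_integral_cmult N1.emeasure_eq_measure m_def)
    finally show ?thesis by (simp only: weight[OF that])
  qed
  have fst: "distr G N1 fst = N1"
  proof (rule measure_eqI)
    fix A assume "A \<in> sets (distr G N1 fst)"
    then have [measurable]: "A \<in> sets N1" by simp
    have "emeasure (distr G N1 fst) A = (\<integral>\<^sup>+z. g z * indicator A (fst z) \<partial>(N1 \<Otimes>\<^sub>M N2))"
      by (subst emeasure_distr)
         (auto simp: G_def emeasure_density split: split_indicator intro!: nn_integral_cong)
    also have "\<dots> = (\<integral>\<^sup>+s. (\<integral>\<^sup>+t. g (s, t) * indicator A s \<partial>N2) \<partial>N1)"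
      by (subst N2.nn_integral_fst[symmetric]) simp_all
    also have "\<dots> = (\<integral>\<^sup>+s. indicator A s \<partial>N1)"
    proof (rule nn_integral_cong_AE)
      show "AE s in N1. (\<integral>\<^sup>+t. g (s, t) * indicator A s \<partial>N2) = indicator A s"
        using prob_space.AE_label_positive[OF N1 a] AE_space
        by eventually_elim (simp add: nn_integral_multc inner2 m_def)
    qed
    finally show "emeasure (distr G N1 fst) A = emeasure N1 A" by simp
  qed simp
  have snd: "distr G N2 snd = N2"
  proof (rule measure_eqI)
    fix B assume "B \<in> sets (distr G N2 snd)"
    then have [measurable]: "B \<in> sets N2" by simp
    have "emeasure (distr G N2 snd) B = (\<integral>\<^sup>+z. g z * indicator B (snd z) \<partial>(N1 \<Otimes>\<^sub>M N2))"
      by (subst emeasure_distr)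
         (auto simp: G_def emeasure_density split: split_indicator intro!: nn_integral_cong)
    also have "\<dots> = (\<integral>\<^sup>+t. (\<integral>\<^sup>+s. g (s, t) * indicator B t \<partial>N1) \<partial>N2)"
      by (subst P.nn_integral_snd[symmetric]) simp_all
    also have "\<dots> = (\<integral>\<^sup>+t. indicator B t \<partial>N2)"
    proof (rule nn_integral_cong_AE)
      show "AE t in N2. (\<integral>\<^sup>+s. g (s, t) * indicator B t \<partial>N1) = indicator B t"
        using prob_space.AE_label_positive[OF N2 b] AE_space
        by eventually_elim (simp add: nn_integral_multc inner1 m2)
    qed
    finally show "emeasure (distr G N2 snd) B = emeasure N2 B" by simp
  qed simp
  have "fst \<in> measurable G N1" "snd \<in> measurable G N2" by (simp_all add: G_def)
  then have mp: "measure_preserving G N1 fst" "measure_preserving G N2 snd"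
    using fst snd by (simp_all add: measure_preserving_def)
  have "prob_space (distr G N1 fst)" by (simp add: fst N1)
  then have G: "prob_space G" by (rule prob_space_distrD[OF \<open>fst \<in> measurable G N1\<close>])
  have AE: "AE z in G. a (fst z) = b (snd z)"
    unfolding G_def AE_density[OF g_measurable]
    by (rule AE_I2) (auto simp: g_def split: if_splits)
  show thesis by (rule that[OF G mp AE])
qed

lemma measure_preserving_comp:
  assumes "measure_preserving G N \<theta>" "measure_preserving N M \<phi>"
  shows "measure_preserving G M (\<lambda>x. \<phi> (\<theta> x))"
proof -
  have m: "\<theta> \<in> measurable G N" "\<phi> \<in> measurable N M" and d: "distr G N \<theta> = N" "distr N M \<phi> = M"
    using assms by (auto simp: measure_preserving_def)
  have "distr G M (\<lambda>x. \<phi> (\<theta> x)) = distr (distr G N \<theta>) M \<phi>"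
    by (simp add: distr_distr[OF m(2,1)] o_def)
  then show ?thesis
    unfolding measure_preserving_def using measurable_compose[OF m] by (simp only: d simp_thms)
qed

lemma measure_label_pullback:
  assumes \<phi>: "measure_preserving N M \<phi>" and p [measurable]: "p \<in> measurable M (count_space UNIV)"
  shows "measure N {s \<in> space N. p (\<phi> s) = i} = measure M {x \<in> space M. p x = i}"
proof -
  have \<phi>m: "\<phi> \<in> measurable N M" and d: "distr N M \<phi> = M" using \<phi> by (auto simp: measure_preserving_def)
  have "measure M {x \<in> space M. p x = i} = measure (distr N M \<phi>) {x \<in> space M. p x = i}"
    by (simp add: d)
  also have "\<dots> = measure N (\<phi> -` {x \<in> space M. p x = i} \<inter> space N)"
    by (rule measure_distr[OF \<phi>m]) measurable
  also have "\<phi> -` {x \<in> space M. p x = i} \<inter> space N = {s \<in> space N. p (\<phi> s) = i}"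
    using measurable_space[OF \<phi>m] by auto
  finally show ?thesis by simp
qed

text \<open>On general probability spaces two couplings cannot be glued along the middle space. But the
  middle kernel is \<open>L\<^sup>1\<close>-close to a step kernel, which only sees a finite label.\<close>

lemma delta_cut_le_glued:
  fixes M1 :: "'a measure" and M2 :: "'b measure" and M3 :: "'c measure"
    and N :: "'d measure" and N' :: "'e measure"
  assumes M2: "prob_space M2"
    and W: "integrable (M1 \<Otimes>\<^sub>M M1) W1" "integrable (M2 \<Otimes>\<^sub>M M2) W2" "integrable (M3 \<Otimes>\<^sub>M M3) W3"
    and N: "(N, \<phi>1, \<phi>2) \<in> couplings M1 M2" and N': "(N', \<psi>2, \<psi>3) \<in> couplings M2 M3"
    and "0 < e"
  shows "delta_cut M1 M3 W1 W3 \<le> cut_norm N (\<lambda>z. pullback \<phi>1 W1 z - pullback \<phi>2 W2 z) +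
    cut_norm N' (\<lambda>z. pullback \<psi>2 W2 z - pullback \<psi>3 W3 z) + e"
proof -
  interpret M2: prob_space M2 by (rule M2)
  note mpN = couplingsD(1-3)[OF N] and mpN' = couplingsD(1-3)[OF N']
  have "step_approximable M2 W2" by (rule M2.integrable_step_approximable[OF W(2)])
  then obtain p h where p: "finite_labelling M2 p"
    and ph: "L1_dist (M2 \<Otimes>\<^sub>M M2) W2 (pullback p h) < e / 2"
    unfolding step_approximable_def using \<open>0 < e\<close> half_gt_zero by blast
  define U where "U = pullback p h"
  have U: "integrable (M2 \<Otimes>\<^sub>M M2) U" unfolding U_def by (rule M2.step_kernel_integrable[OF p])
  have pm [measurable]: "p \<in> measurable M2 (count_space UNIV)"
    using p by (simp add: finite_labelling_def)
  have \<phi>2m [measurable]: "\<phi>2 \<in> measurable N M2" and \<psi>2m [measurable]: "\<psi>2 \<in> measurable N' M2"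
    using couplingsD(5)[OF N] couplingsD(4)[OF N'] .
  have labels: "(\<lambda>s. p (\<phi>2 s)) \<in> measurable N (count_space UNIV)"
    "(\<lambda>t. p (\<psi>2 t)) \<in> measurable N' (count_space UNIV)" by measurable
  have "measure N {s \<in> space N. p (\<phi>2 s) = i} = measure N' {t \<in> space N'. p (\<psi>2 t) = i}" for i
    by (simp add: measure_label_pullback[OF mpN(3) pm] measure_label_pullback[OF mpN'(2) pm])
  then obtain G :: "('d \<times> 'e) measure" where G: "prob_space G" "measure_preserving G N fst"
    "measure_preserving G N' snd" and label: "AE z in G. p (\<phi>2 (fst z)) = p (\<psi>2 (snd z))"
    using glue_along_labels[OF mpN(1) mpN'(1) labels] by blast
  interpret G: prob_space G by fact
  interpret GG: pair_prob_space G G ..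
  have [measurable]: "fst \<in> measurable G N" "snd \<in> measurable G N'"
    using G(2,3) by (simp_all add: measure_preserving_def)
  have coup: "(G, \<lambda>z. \<phi>1 (fst z), \<lambda>z. \<psi>3 (snd z)) \<in> couplings M1 M3"
    unfolding couplings_def
    using G measure_preserving_comp[OF G(2) mpN(2)] measure_preserving_comp[OF G(3) mpN'(3)] by auto
  define X where "X = (\<lambda>z. pullback \<phi>1 W1 z - pullback \<phi>2 U z)"
  define Y where "Y = (\<lambda>z. pullback \<psi>2 U z - pullback \<psi>3 W3 z)"
  have X: "integrable (N \<Otimes>\<^sub>M N) X" unfolding X_def by (rule integrable_coupling_diff[OF N W(1) U])
  have Y: "integrable (N' \<Otimes>\<^sub>M N') Y" unfolding Y_def by (rule integrable_coupling_diff[OF N' U W(3)])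
  note X' = integrable_pullback[OF G(1,2) X] and Y' = integrable_pullback[OF G(1,3) Y]
  have "delta_cut M1 M3 W1 W3 \<le>
      cut_norm G (\<lambda>z. pullback (\<lambda>z. \<phi>1 (fst z)) W1 z - pullback (\<lambda>z. \<psi>3 (snd z)) W3 z)"
    by (rule delta_cut_le[OF coup W(1,3)])
  \<comment> \<open>On \<open>G\<close> the two middle labels agree almost surely, so both pullbacks
    of the step kernel \<open>U\<close> coincide and cancel. For \<open>W2\<close> itself this could
    fail, as equal labels do not give equal points.\<close>
  also have "\<dots> = cut_norm G (\<lambda>z. pullback fst X z + pullback snd Y z)"
  proof (rule cut_norm_cong)
    have "AE s in G. AE t in G. p (\<phi>2 (fst s)) = p (\<psi>2 (snd s)) \<and> p (\<phi>2 (fst t)) = p (\<psi>2 (snd t))"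
      using label by eventually_elim (use label in auto)
    then have "AE z in G \<Otimes>\<^sub>M G. p (\<phi>2 (fst (fst z))) = p (\<psi>2 (snd (fst z))) \<and>
        p (\<phi>2 (fst (snd z))) = p (\<psi>2 (snd (snd z)))"
    proof (intro GG.AE_pair_measure)
      let ?A = "{s \<in> space G. p (\<phi>2 (fst s)) = p (\<psi>2 (snd s))}"
      have A [measurable]: "?A \<in> sets G" by (rule sets_labels_eq) measurable
      have "?A \<times> ?A \<in> sets (G \<Otimes>\<^sub>M G)" by measurable
      also have "?A \<times> ?A = {z \<in> space (G \<Otimes>\<^sub>M G). p (\<phi>2 (fst (fst z))) = p (\<psi>2 (snd (fst z))) \<and>
          p (\<phi>2 (fst (snd z))) = p (\<psi>2 (snd (snd z)))}"
        by (auto simp: space_pair_measure)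
      finally show "{z \<in> space (G \<Otimes>\<^sub>M G). p (\<phi>2 (fst (fst z))) = p (\<psi>2 (snd (fst z))) \<and>
          p (\<phi>2 (fst (snd z))) = p (\<psi>2 (snd (snd z)))} \<in> sets (G \<Otimes>\<^sub>M G)" .
    qed simp
    then show "AE z in G \<Otimes>\<^sub>M G. pullback (\<lambda>z. \<phi>1 (fst z)) W1 z - pullback (\<lambda>z. \<psi>3 (snd z)) W3 z =
        pullback fst X z + pullback snd Y z"
      by eventually_elim (auto simp: X_def Y_def U_def pullback_def split_beta)
  qed (use X' Y' borel_measurable_integrable[OF integrable_coupling_diff[OF coup W(1,3)]] in auto)
  also have "\<dots> \<le> cut_norm G (pullback fst X) + cut_norm G (pullback snd Y)"
    by (rule cut_norm_triangle[OF X' Y'])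
  \<comment> \<open>Test functions on \<open>G\<close> may depend on both components; the invariance
    of the cut norm under pullback is what returns the bounds to \<open>N\<close> and
    \<open>N'\<close>.\<close>
  also have "\<dots> \<le> cut_norm N X + cut_norm N' Y"
    by (intro add_mono cut_norm_pullback_le G mpN(1) mpN'(1) X Y)
  also have "cut_norm N X \<le> cut_norm N (\<lambda>z. pullback \<phi>1 W1 z - pullback \<phi>2 W2 z) + e / 2"
  proof -
    let ?V = "\<lambda>z. W2 z - U z"
    have V: "integrable (M2 \<Otimes>\<^sub>M M2) ?V" using W(2) U by auto
    note V' = integrable_pullback[OF mpN(1,3) V]
    have "X = (\<lambda>z. (pullback \<phi>1 W1 z - pullback \<phi>2 W2 z) + pullback \<phi>2 ?V z)"
      by (auto simp: X_def pullback_def)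
    then have "cut_norm N X \<le> cut_norm N (\<lambda>z. pullback \<phi>1 W1 z - pullback \<phi>2 W2 z) +
        cut_norm N (pullback \<phi>2 ?V)"
      using cut_norm_triangle[OF integrable_coupling_diff[OF N W(1,2)] V'] by simp
    moreover have "cut_norm N (pullback \<phi>2 ?V) \<le> L1_norm (M2 \<Otimes>\<^sub>M M2) ?V"
      using cut_norm_le_L1_norm[OF V'] L1_norm_pullback[OF mpN(1,3) borel_measurable_integrable[OF V]]
      by simp
    ultimately show ?thesis using ph by (simp add: L1_dist_def U_def)
  qed
  also have "cut_norm N' Y \<le> cut_norm N' (\<lambda>z. pullback \<psi>2 W2 z - pullback \<psi>3 W3 z) + e / 2"
  proof -
    let ?V = "\<lambda>z. U z - W2 z"
    have V: "integrable (M2 \<Otimes>\<^sub>M M2) ?V" using W(2) U by auto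
    note V' = integrable_pullback[OF mpN'(1,2) V]
    have "Y = (\<lambda>z. (pullback \<psi>2 W2 z - pullback \<psi>3 W3 z) + pullback \<psi>2 ?V z)"
      by (auto simp: Y_def pullback_def)
    then have "cut_norm N' Y \<le> cut_norm N' (\<lambda>z. pullback \<psi>2 W2 z - pullback \<psi>3 W3 z) +
        cut_norm N' (pullback \<psi>2 ?V)"
      using cut_norm_triangle[OF integrable_coupling_diff[OF N' W(2,3)] V'] by simp
    moreover have "cut_norm N' (pullback \<psi>2 ?V) \<le> L1_norm (M2 \<Otimes>\<^sub>M M2) ?V"
      using cut_norm_le_L1_norm[OF V'] L1_norm_pullback[OF mpN'(1,2) borel_measurable_integrable[OF V]]
      by simp
    ultimately show ?thesis using ph by (simp add: L1_dist_def L1_norm_def U_def abs_minus_commute)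
  qed
  finally show ?thesis by simp
qed

text \<open>The gluing error is arbitrarily small, so the bound holds for each pair of couplings;
  then the two infima are taken in turn.\<close>

lemma delta_cut_triangle:
  fixes M1 :: "'a measure" and M2 :: "'b measure" and M3 :: "'c measure"
  assumes prob: "prob_space M1" "prob_space M2" "prob_space M3"
    and W: "integrable (M1 \<Otimes>\<^sub>M M1) W1" "integrable (M2 \<Otimes>\<^sub>M M2) W2" "integrable (M3 \<Otimes>\<^sub>M M3) W3"
  shows "delta_cut M1 M3 W1 W3 \<le> delta_cut M1 M2 W1 W2 + delta_cut M2 M3 W2 W3"
proof -
  let ?d = "delta_cut M1 M3 W1 W3"
  let ?c = "\<lambda>(N :: ('a \<times> 'b) measure, \<phi>1, \<phi>2). cut_norm N (\<lambda>z. pullback \<phi>1 W1 z - pullback \<phi>2 W2 z)"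
  let ?c' = "\<lambda>(N :: ('b \<times> 'c) measure, \<phi>1, \<phi>2). cut_norm N (\<lambda>z. pullback \<phi>1 W2 z - pullback \<phi>2 W3 z)"
  have le: "?d \<le> ?c N + ?c' N'" if "N \<in> couplings M1 M2" "N' \<in> couplings M2 M3" for N N'
  proof -
    obtain K \<phi>1 \<phi>2 K' \<psi>2 \<psi>3 where "N = (K, \<phi>1, \<phi>2)" "N' = (K', \<psi>2, \<psi>3)"
      by (metis prod_cases3)
    with that show ?thesis
      using delta_cut_le_glued[OF prob(2) W, of K \<phi>1 \<phi>2 K' \<psi>2 \<psi>3] by (simp add: field_le_epsilon)
  qed
  have "?d - ?c N \<le> delta_cut M2 M3 W2 W3" if "N \<in> couplings M1 M2" for N
    unfolding delta_cut_def[of M2]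
    using le[OF that] couplings_nonempty[OF prob(2,3)]
    by (intro cINF_greatest) (auto simp: algebra_simps)
  then have "?d - delta_cut M2 M3 W2 W3 \<le> delta_cut M1 M2 W1 W2"
    unfolding delta_cut_def[of M1 M2]
    using couplings_nonempty[OF prob(1,2)]
    by (intro cINF_greatest) (auto simp: algebra_simps)
  then show ?thesis by simp
qed


section \<open>Comparison of the metrics\<close>

text \<open>The identity is continuous from a compact space onto a Hausdorff space, hence closed: a
  closed set of the finer topology is compact, remains compact in the coarser one, and is therefore
  closed there.\<close>

lemma mtopology_eq_if_compact_le:
  assumes d: "Metric_space X d" and d': "Metric_space X d'"
    and le: "\<And>x y. x \<in> X \<Longrightarrow> y \<in> X \<Longrightarrow> d' x y \<le> d x y"
    and compact: "compact_space (Metric_space.mtopology X d)"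
  shows "Metric_space.mtopology X d' = Metric_space.mtopology X d"
proof -
  interpret d: Metric_space X d by fact
  interpret d': Metric_space X d' by fact
  have finer: "openin d.mtopology U" if U: "openin d'.mtopology U" for U
    unfolding d.openin_mtopology
  proof (intro conjI allI impI)
    show "U \<subseteq> X" using U by (simp add: d'.openin_mtopology)
    fix x assume "x \<in> U"
    then obtain e where "0 < e" "d'.mball x e \<subseteq> U" using U unfolding d'.openin_mtopology by blast
    moreover have "d.mball x e \<subseteq> d'.mball x e" by (auto intro: le_less_trans[OF le])
    ultimately show "\<exists>e>0. d.mball x e \<subseteq> U" by blast
  qed
  have cont: "continuous_map d.mtopology d'.mtopology id"
    unfolding continuous_map
  proof (intro conjI allI impI)
    fix U assume U: "openin d'.mtopology U"
    then have "{x \<in> topspace d.mtopology. id x \<in> U} = U" by (auto simp: d'.openin_mtopology)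
    then show "openin d.mtopology {x \<in> topspace d.mtopology. id x \<in> U}" using finer[OF U] by simp
  qed simp
  have "openin d'.mtopology U" if U: "openin d.mtopology U" for U
  proof -
    have "closedin d.mtopology (X - U)" using U by (metis closedin_diff closedin_topspace d.topspace_mtopology)
    then have "compactin d.mtopology (X - U)" by (rule closedin_compact_space[OF compact])
    from image_compactin[OF this cont] have "compactin d'.mtopology (X - U)" by simp
    then have "closedin d'.mtopology (X - U)"
      by (rule compactin_imp_closedin[OF d'.Hausdorff_space_mtopology])
    moreover have "X - (X - U) = U" using U by (auto simp: d.openin_mtopology)
    ultimately show ?thesis
      using openin_diff[OF openin_topspace[of d'.mtopology], of "X - U"] by simp
  qed
  with finer show ?thesis by (auto simp: topology_eq)
qed

lemma L1_dist_eq_0_iff: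
  assumes "integrable M f" "integrable M g"
  shows "L1_dist M f g = 0 \<longleftrightarrow> (AE z in M. f z = g z)"
proof -
  have "L1_dist M f g = 0 \<longleftrightarrow> (AE z in M. \<bar>f z - g z\<bar> = 0)"
    unfolding L1_dist_def L1_norm_def
    by (rule integral_nonneg_eq_0_iff_AE) (use assms in auto)
  then show ?thesis by simp
qed

section \<open>Metric axioms for the distances and inequalities between them\<close>

context prob_space
begin

lemma delta_cut_nonneg:
  assumes "integrable (M \<Otimes>\<^sub>M M) V" "integrable (M \<Otimes>\<^sub>M M) W"
  shows "0 \<le> delta_cut M M V W"
  unfolding delta_cut_def
  using couplings_nonempty[OF prob_space_axioms prob_space_axioms]
  by (intro cINF_greatest) (auto intro!: cut_norm_nonneg integrable_coupling_diff assms)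

lemma delta_1_nonneg: "0 \<le> delta_1 M M V W"
  unfolding delta_1_def
  using couplings_nonempty[OF prob_space_axioms prob_space_axioms]
  by (intro cINF_greatest) (auto simp: L1_norm_def)

lemma delta_cut_commute:
  assumes V: "integrable (M \<Otimes>\<^sub>M M) V" and W: "integrable (M \<Otimes>\<^sub>M M) W"
  shows "delta_cut M M V W = delta_cut M M W V"
proof -
  have le: "delta_cut M M V W \<le> delta_cut M M W V"
    if V: "integrable (M \<Otimes>\<^sub>M M) V" and W: "integrable (M \<Otimes>\<^sub>M M) W" for V W
    unfolding delta_cut_def[of M M W V]
  proof (rule cINF_greatest)
    fix x :: "('a \<times> 'a) measure \<times> ('a \<times> 'a \<Rightarrow> 'a) \<times> ('a \<times> 'a \<Rightarrow> 'a)"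
    assume "x \<in> couplings M M"
    then obtain N \<phi> \<psi> where x: "x = (N, \<phi>, \<psi>)" and N: "(N, \<psi>, \<phi>) \<in> couplings M M"
      by (cases x) (auto simp: couplings_def)
    show "delta_cut M M V W \<le>
        (case x of (N, \<phi>, \<psi>) \<Rightarrow> cut_norm N (\<lambda>z. pullback \<phi> W z - pullback \<psi> V z))"
      using delta_cut_le[OF N V W] cut_norm_minus[of N "\<lambda>z. pullback \<psi> V z - pullback \<phi> W z"]
      by (simp add: x)
  qed (use couplings_nonempty[OF prob_space_axioms prob_space_axioms] in blast)
  show ?thesis by (rule antisym) (rule le[OF V W], rule le[OF W V])
qed

lemma delta_1_commute:
  assumes V: "integrable (M \<Otimes>\<^sub>M M) V" and W: "integrable (M \<Otimes>\<^sub>M M) W"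
  shows "delta_1 M M V W = delta_1 M M W V"
proof -
  have le: "delta_1 M M V W \<le> delta_1 M M W V"
    if V: "integrable (M \<Otimes>\<^sub>M M) V" and W: "integrable (M \<Otimes>\<^sub>M M) W" for V W
    unfolding delta_1_def[of M M W V]
  proof (rule cINF_greatest)
    fix x :: "('a \<times> 'a) measure \<times> ('a \<times> 'a \<Rightarrow> 'a) \<times> ('a \<times> 'a \<Rightarrow> 'a)"
    assume "x \<in> couplings M M"
    then obtain N \<phi> \<psi> where x: "x = (N, \<phi>, \<psi>)" and N: "(N, \<psi>, \<phi>) \<in> couplings M M"
      by (cases x) (auto simp: couplings_def)
    show "delta_1 M M V W \<le>
        (case x of (N, \<phi>, \<psi>) \<Rightarrow> L1_norm (N \<Otimes>\<^sub>M N) (\<lambda>z. pullback \<phi> W z - pullback \<psi> V z))"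
      using delta_1_le[OF N V W] by (simp add: x L1_norm_def abs_minus_commute)
  qed (use couplings_nonempty[OF prob_space_axioms prob_space_axioms] in blast)
  show ?thesis by (rule antisym) (rule le[OF V W], rule le[OF W V])
qed

lemma delta_cut_le_cut_norm_dist:
  assumes "integrable (M \<Otimes>\<^sub>M M) V" "integrable (M \<Otimes>\<^sub>M M) W"
  shows "delta_cut M M V W \<le> cut_norm_dist M V W"
proof -
  have "(M, \<lambda>x. x, \<lambda>x. x) \<in> couplings M M"
    by (auto simp: couplings_def measure_preserving_def prob_space_axioms)
  from delta_cut_le[OF this assms] show ?thesis
    by (simp add: cut_norm_dist_def pullback_def)
qed

lemma cut_norm_dist_le_L1_dist:
  assumes "integrable (M \<Otimes>\<^sub>M M) V" "integrable (M \<Otimes>\<^sub>M M) W"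
  shows "cut_norm_dist M V W \<le> L1_dist (M \<Otimes>\<^sub>M M) V W"
  unfolding cut_norm_dist_def L1_dist_def using assms by (intro cut_norm_le_L1_norm) auto

lemma cut_norm_dist_triangle:
  assumes "integrable (M \<Otimes>\<^sub>M M) U" "integrable (M \<Otimes>\<^sub>M M) V" "integrable (M \<Otimes>\<^sub>M M) W"
  shows "cut_norm_dist M U W \<le> cut_norm_dist M U V + cut_norm_dist M V W"
  using cut_norm_triangle[of M "\<lambda>z. U z - V z" "\<lambda>z. V z - W z"] assms
  by (simp add: cut_norm_dist_def)

end

context ordered_prob_space
begin

lemma compact_space_monotone_kernels:
  "compact_space (Metric_space.mtopology (monotone_kernels M r)
     (L1_lift2 (M \<Otimes>\<^sub>M M) (L1_dist (M \<Otimes>\<^sub>M M))))"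
proof -
  interpret S: Submetric "L1_space (M \<Otimes>\<^sub>M M)" "L1_lift2 (M \<Otimes>\<^sub>M M) (L1_dist (M \<Otimes>\<^sub>M M))" "monotone_kernels M r"
    using Metric_space_L1 by (intro Submetric.intro Submetric_axioms.intro) (auto simp: monotone_kernels_def)
  show ?thesis
    unfolding S.mtopology_submetric by (rule compact_space_subtopology[OF compactin_monotone_kernels])
qed

text \<open>Any lifted metric squeezed between \<open>\<delta>\<^sub>\<box>\<close> and the \<open>L\<^sup>1\<close> metric separates points, and it is
  coarser than the compact \<open>L\<^sup>1\<close> topology, hence induces the same topology.\<close>

lemma metric_between_delta_cut_and_L1:
  assumes resp: "F respects2 L1_rel (M \<Otimes>\<^sub>M M)"
    and nonneg: "\<And>V W. integrable (M \<Otimes>\<^sub>M M) V \<Longrightarrow> integrable (M \<Otimes>\<^sub>M M) W \<Longrightarrow> 0 \<le> F V W"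
    and commute: "\<And>V W. integrable (M \<Otimes>\<^sub>M M) V \<Longrightarrow> integrable (M \<Otimes>\<^sub>M M) W \<Longrightarrow> F V W = F W V"
    and lower: "\<And>V W. monotone_kernel M r V \<Longrightarrow> monotone_kernel M r W \<Longrightarrow> delta_cut M M V W \<le> F V W"
    and upper: "\<And>V W. monotone_kernel M r V \<Longrightarrow> monotone_kernel M r W \<Longrightarrow>
      F V W \<le> L1_dist (M \<Otimes>\<^sub>M M) V W"
    and triangle: "\<And>U V W. monotone_kernel M r U \<Longrightarrow> monotone_kernel M r V \<Longrightarrow>
      monotone_kernel M r W \<Longrightarrow> F U W \<le> F U V + F V W"
  shows "Metric_space (monotone_kernels M r) (L1_lift2 (M \<Otimes>\<^sub>M M) F)"
    and "Metric_space.mtopology (monotone_kernels M r) (L1_lift2 (M \<Otimes>\<^sub>M M) F) =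
      Metric_space.mtopology (monotone_kernels M r) (L1_lift2 (M \<Otimes>\<^sub>M M) (L1_dist (M \<Otimes>\<^sub>M M)))"
proof -
  note lift = L1_lift2_class[OF resp] and int = monotone_kernel_integrable
    and lift_L1 = L1_lift2_class[OF L1_dist_respects[of "M \<Otimes>\<^sub>M M"]]
  have zero: "F V W = 0 \<longleftrightarrow> (AE z in M \<Otimes>\<^sub>M M. V z = W z)"
    if V: "monotone_kernel M r V" and W: "monotone_kernel M r W" for V W
  proof -
    have "F V W = 0 \<longleftrightarrow> L1_dist (M \<Otimes>\<^sub>M M) V W = 0"
      using lower[OF V W] upper[OF V W] nonneg[OF int[OF V] int[OF W]]
        delta_cut_nonneg[OF int[OF V] int[OF W]] L1_dist_0_if_delta_cut_0[OF V W]
      by linarith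
    then show ?thesis using L1_dist_eq_0_iff[OF int[OF V] int[OF W]] by simp
  qed
  show metric: "Metric_space (monotone_kernels M r) (L1_lift2 (M \<Otimes>\<^sub>M M) F)"
  proof
    fix A B C :: "('a \<times> 'a \<Rightarrow> real) set"
    \<comment> \<open>\<open>Metric_space\<close> demands nonnegativity and symmetry for all
      arguments, even outside the carrier. This is why \<open>nonneg\<close> and
      \<open>commute\<close> range over integrable functions and not only over monotone
      kernels.\<close>
    show "0 \<le> L1_lift2 (M \<Otimes>\<^sub>M M) F A B"
    proof (cases "A \<in> L1_space (M \<Otimes>\<^sub>M M) \<and> B \<in> L1_space (M \<Otimes>\<^sub>M M)")
      case True
      then show ?thesis by (auto elim!: L1_space_cases simp: lift nonneg)
    qed (auto simp: L1_lift2_def)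
    show "L1_lift2 (M \<Otimes>\<^sub>M M) F A B = L1_lift2 (M \<Otimes>\<^sub>M M) F B A"
    proof (cases "A \<in> L1_space (M \<Otimes>\<^sub>M M) \<and> B \<in> L1_space (M \<Otimes>\<^sub>M M)")
      case True
      then obtain V W where VW: "integrable (M \<Otimes>\<^sub>M M) V" "A = L1_class (M \<Otimes>\<^sub>M M) V"
        "integrable (M \<Otimes>\<^sub>M M) W" "B = L1_class (M \<Otimes>\<^sub>M M) W"
        by (auto elim!: L1_space_cases)
      then show ?thesis using commute[OF VW(1,3)] by (simp add: lift)
    qed (auto simp: L1_lift2_def)
    assume "A \<in> monotone_kernels M r" "B \<in> monotone_kernels M r"
    then obtain V W where V: "monotone_kernel M r V" "A = L1_class (M \<Otimes>\<^sub>M M) V"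
      and W: "monotone_kernel M r W" "B = L1_class (M \<Otimes>\<^sub>M M) W"
      unfolding monotone_kernels_eq by auto
    show "L1_lift2 (M \<Otimes>\<^sub>M M) F A B = 0 \<longleftrightarrow> A = B"
      using zero[OF V(1) W(1)] V W by (simp add: lift int L1_class_eq_iff)
    assume "C \<in> monotone_kernels M r"
    then obtain U where U: "monotone_kernel M r U" "C = L1_class (M \<Otimes>\<^sub>M M) U"
      unfolding monotone_kernels_eq by auto
    show "L1_lift2 (M \<Otimes>\<^sub>M M) F A C \<le> L1_lift2 (M \<Otimes>\<^sub>M M) F A B + L1_lift2 (M \<Otimes>\<^sub>M M) F B C"
      using triangle[OF V(1) W(1) U(1)] U V W by (simp add: lift int)
  qed
  show "Metric_space.mtopology (monotone_kernels M r) (L1_lift2 (M \<Otimes>\<^sub>M M) F) =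
      Metric_space.mtopology (monotone_kernels M r) (L1_lift2 (M \<Otimes>\<^sub>M M) (L1_dist (M \<Otimes>\<^sub>M M)))"
  proof (rule mtopology_eq_if_compact_le[OF _ metric _ compact_space_monotone_kernels])
    show "Metric_space (monotone_kernels M r) (L1_lift2 (M \<Otimes>\<^sub>M M) (L1_dist (M \<Otimes>\<^sub>M M)))"
      by (rule Metric_space.subspace[OF Metric_space_L1]) (auto simp: monotone_kernels_def)
    fix A B assume "A \<in> monotone_kernels M r" "B \<in> monotone_kernels M r"
    then show "L1_lift2 (M \<Otimes>\<^sub>M M) F A B \<le> L1_lift2 (M \<Otimes>\<^sub>M M) (L1_dist (M \<Otimes>\<^sub>M M)) A B"
      unfolding monotone_kernels_eq by (auto simp: lift lift_L1 int upper)
  qed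
qed

lemma delta_cut_eq_0_iff:
  assumes V: "monotone_kernel M r V" and W: "monotone_kernel M r W"
  shows "delta_cut M M V W = 0 \<longleftrightarrow> (AE z in M \<Otimes>\<^sub>M M. V z = W z)"
proof -
  note int = monotone_kernel_integrable[OF V] monotone_kernel_integrable[OF W]
  have "delta_cut M M V W = 0 \<longleftrightarrow> L1_dist (M \<Otimes>\<^sub>M M) V W = 0"
    using delta_cut_nonneg[OF int] L1_dist_0_if_delta_cut_0[OF V W]
      delta_cut_le_cut_norm_dist[OF int] cut_norm_dist_le_L1_dist[OF int] by linarith
  then show ?thesis by (simp add: L1_dist_eq_0_iff[OF int])
qed

text \<open>The given kernels are only almost everywhere equal to monotone ones. Since both sides
  respect almost everywhere equality, monotone representatives may replace them.\<close>

lemma equivalent_kernels_iff_AE_eq: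
  assumes "L1_class (M \<Otimes>\<^sub>M M) W1 \<in> monotone_kernels M r"
    and "L1_class (M \<Otimes>\<^sub>M M) W2 \<in> monotone_kernels M r"
  shows "equivalent_kernels M M W1 W2 \<longleftrightarrow> (AE z in M \<Otimes>\<^sub>M M. W1 z = W2 z)"
proof -
  obtain V1 V2 where V: "monotone_kernel M r V1" "monotone_kernel M r V2"
    and rel: "(W1, V1) \<in> L1_rel (M \<Otimes>\<^sub>M M)" "(W2, V2) \<in> L1_rel (M \<Otimes>\<^sub>M M)"
    using assms by (auto simp: monotone_kernels_def L1_class_def)
  have "delta_cut M M W1 W2 = delta_cut M M V1 V2"
    by (rule congruent2D[OF delta_cut_respects rel])
  moreover have "(AE z in M \<Otimes>\<^sub>M M. V1 z = V2 z) \<longleftrightarrow> (AE z in M \<Otimes>\<^sub>M M. W1 z = W2 z)"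
  proof -
    have "AE z in M \<Otimes>\<^sub>M M. W1 z = V1 z \<and> W2 z = V2 z" using rel by (auto simp: L1_rel_def)
    then have "AE z in M \<Otimes>\<^sub>M M. (V1 z = V2 z) = (W1 z = W2 z)" by eventually_elim simp
    then show ?thesis by (rule eventually_subst)
  qed
  ultimately show ?thesis
    by (simp add: equivalent_kernels_def delta_cut_eq_0_iff[OF V])
qed

end

theorem theorem4p1:
  fixes M :: "'a measure" and r :: "'a rel"
  assumes "ordered_prob_space M r"
  shows
    "compactin (Metric_space.mtopology (L1_space (M \<Otimes>\<^sub>M M)) (L1_lift2 (M \<Otimes>\<^sub>M M) (L1_dist (M \<Otimes>\<^sub>M M))))
       (monotone_kernels M r)
     \<and>
     (\<forall>W1 W2. sym_kernel M W1 \<and> sym_kernel M W2 \<and>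
        L1_class (M \<Otimes>\<^sub>M M) W1 \<in> monotone_kernels M r \<and>
        L1_class (M \<Otimes>\<^sub>M M) W2 \<in> monotone_kernels M r \<longrightarrow>
        (equivalent_kernels M M W1 W2 \<longleftrightarrow> (AE z in M \<Otimes>\<^sub>M M. W1 z = W2 z)))
     \<and>
     (let d_L1 = L1_lift2 (M \<Otimes>\<^sub>M M) (L1_dist (M \<Otimes>\<^sub>M M));
          d_delta1 = L1_lift2 (M \<Otimes>\<^sub>M M) (delta_1 M M);
          d_cut = L1_lift2 (M \<Otimes>\<^sub>M M) (cut_norm_dist M);
          d_deltacut = L1_lift2 (M \<Otimes>\<^sub>M M) (delta_cut M M)
      in Metric_space (monotone_kernels M r) d_L1 \<and>
         Metric_space (monotone_kernels M r) d_delta1 \<and>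
         Metric_space (monotone_kernels M r) d_cut \<and>
         Metric_space (monotone_kernels M r) d_deltacut \<and>
         Metric_space.mtopology (monotone_kernels M r) d_delta1 =
           Metric_space.mtopology (monotone_kernels M r) d_L1 \<and>
         Metric_space.mtopology (monotone_kernels M r) d_cut =
           Metric_space.mtopology (monotone_kernels M r) d_L1 \<and>
         Metric_space.mtopology (monotone_kernels M r) d_deltacut =
           Metric_space.mtopology (monotone_kernels M r) d_L1)"
proof -
  interpret ordered_prob_space M r by fact
  let ?L1 = "L1_lift2 (M \<Otimes>\<^sub>M M) (L1_dist (M \<Otimes>\<^sub>M M))"
  note int = monotone_kernel_integrable
  have L1: "Metric_space (monotone_kernels M r) ?L1"
    by (rule Metric_space.subspace[OF Metric_space_L1]) (auto simp: monotone_kernels_def)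
  have cut_le_L1: "delta_cut M M V W \<le> L1_dist (M \<Otimes>\<^sub>M M) V W"
    if "monotone_kernel M r V" "monotone_kernel M r W" for V W
    using delta_cut_le_cut_norm_dist cut_norm_dist_le_L1_dist int[OF that(1)] int[OF that(2)]
    by (meson order.trans)
  \<comment> \<open>On monotone kernels \<open>delta_1\<close> equals the L1 distance, from which it
    inherits the triangle inequality and the lower bound by \<open>delta_cut\<close>.\<close>
  have d1: "Metric_space (monotone_kernels M r) (L1_lift2 (M \<Otimes>\<^sub>M M) (delta_1 M M))"
    "Metric_space.mtopology (monotone_kernels M r) (L1_lift2 (M \<Otimes>\<^sub>M M) (delta_1 M M)) =
      Metric_space.mtopology (monotone_kernels M r) ?L1"
    by (rule metric_between_delta_cut_and_L1;
        simp add: delta_1_respects delta_1_nonneg delta_1_commute delta_1_eq_L1_dist cut_le_L1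
          L1_dist_triangle int)+
  have cut: "Metric_space (monotone_kernels M r) (L1_lift2 (M \<Otimes>\<^sub>M M) (cut_norm_dist M))"
    "Metric_space.mtopology (monotone_kernels M r) (L1_lift2 (M \<Otimes>\<^sub>M M) (cut_norm_dist M)) =
      Metric_space.mtopology (monotone_kernels M r) ?L1"
  proof -
    have nonneg: "0 \<le> cut_norm_dist M V W"
      if "integrable (M \<Otimes>\<^sub>M M) V" "integrable (M \<Otimes>\<^sub>M M) W" for V W
      using that by (auto simp: cut_norm_dist_def intro!: cut_norm_nonneg)
    have commute: "cut_norm_dist M V W = cut_norm_dist M W V" for V W
      using cut_norm_minus[of M "\<lambda>z. V z - W z"] by (simp add: cut_norm_dist_def)
    show "Metric_space (monotone_kernels M r) (L1_lift2 (M \<Otimes>\<^sub>M M) (cut_norm_dist M))"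
      "Metric_space.mtopology (monotone_kernels M r) (L1_lift2 (M \<Otimes>\<^sub>M M) (cut_norm_dist M)) =
        Metric_space.mtopology (monotone_kernels M r) ?L1"
      by (rule metric_between_delta_cut_and_L1[OF cut_norm_dist_respects nonneg commute];
          simp add: delta_cut_le_cut_norm_dist cut_norm_dist_le_L1_dist cut_norm_dist_triangle int)+
  qed
  have dcut: "Metric_space (monotone_kernels M r) (L1_lift2 (M \<Otimes>\<^sub>M M) (delta_cut M M))"
    "Metric_space.mtopology (monotone_kernels M r) (L1_lift2 (M \<Otimes>\<^sub>M M) (delta_cut M M)) =
      Metric_space.mtopology (monotone_kernels M r) ?L1"
    by (rule metric_between_delta_cut_and_L1[OF delta_cut_respects delta_cut_nonneg delta_cut_commute];
        simp add: cut_le_L1 delta_cut_triangle prob_space_axioms int)+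
  show ?thesis
    unfolding Let_def
    using compactin_monotone_kernels equivalent_kernels_iff_AE_eq L1 d1 cut dcut by blast
qed

end
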